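(* Let $r\ge2$, $s\ge1$, and let $F_1,\dots,F_s\in\mathbb Z[X_1,\dots,X_r]$ be nonzero homogeneous polynomials of degrees $\delta_1,\dots,\delta_s\ge1$ with nonnegative coefficients. Let $\Psi$ and the sparse radial graph family $\mathscr Y_\Psi$ be those associated to $F_1,\dots,F_s$, and let $\mathcal R_X$, $V(X)$, $V_j(\mathcal R_X)$, $D(X)$ be as defined in the context. Assume that $V(X)\to\infty$ and $D(X)\to\infty$ as $X\to\infty$, and that $$D(X)+V_1(\mathcal R_X)\log\bigl(2D(X)\bigr)+\sum_{j=2}^{r-1}V_j(\mathcal R_X)=o\bigl(V(X)\bigr),$$ where the final sum is omitted when $r=2$. Then a branch point $\Psi(x_1,\dots,x_r)$ (with $x\in\mathbb Z_{\ge1}^r$) is globally visible if and only if $\gcd(x_1,\dots,x_r)=1$. For every prime $p$, it is $p$-adically visible if and only if $p$ does not divide all of $x_1,\dots,x_r$. In particular, visibility is locally detectable: a branch point is globally visible if and only if it is $p$-adically visible for every prime $p$. Moreover, $$\#\mathcal B(\mathscr Y_\Psi;X)=V(X)+o(V(X))\quad\text{and}\quad \#\mathcal B^{\mathrm{vis}}(\mathscr Y_\Psi;X)=\frac{V(X)}{\zeta(r)}+o(V(X)).$$ For every prime $p$, $\mathfrak d_p^{\mathrm{vis}}(\mathscr Y_\Psi)=1-\frac1{p^r}$, while $\mathfrak d^{\mathrm{vis}}(\mathscr Y_\Psi)=\frac1{\zeta(r)}$. Consequently $\mathfrak d^{\mathrm{vis}}(\mathscr Y_\Psi)=\prod_p\mathfrak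 d_p^{\mathrm{vis}}(\mathscr Y_\Psi)$.
   Context: Graph map: $\Psi(x_1,\dots,x_r)=(x_1,\dots,x_r,F_1(x),\dots,F_s(x))\in\mathbb R^{r+s}$. For $\boldsymbol a=(a_2,\dots,a_r)\in\mathbb Q_{>0}^{r-1}$ the ordered branch is $\phi_{\boldsymbol a}(t)=\Psi(t,a_2t,\dots,a_rt)$, $t>0$; $\mathscr Y_\Psi$ is the collection of all these branches. Its branch locus $\mathcal B(\mathscr Y_\Psi)$ is the set of integral points $\phi_{\boldsymbol a}(t)\in\mathbb Z^{r+s}$ with $t>0$; it equals $\{\Psi(x):x\in\mathbb Z_{\ge1}^r\}$. For $P\in\mathbb Z^{r+s}$ put $H(P)=\max_i|P_i|$ (also used for real vectors) and $v_p(P)=\min_iv_p(P_i)$. A point $\phi_{\boldsymbol a}(t)\in\mathcal B(\mathscr Y_\Psi)$ is globally visible if there is no $s$ with $0<s<t$ and $\phi_{\boldsymbol a}(s)$ integral; it is $p$-adically visible if $v_p(\phi_{\boldsymbol a}(t))\le v_p(\phi_{\boldsymbol a}(s))$ for every such $s$. $\mathcal B(\mathscr Y_\Psi;X)$ and $\mathcal B^{\mathrm{vis}}(\mathscr Y_\Psi;X)$ are the sets of branch points, resp. globally visible branch points, with $H\le X$. $\mathfrak d^{\mathrm{vis}}$ and $\mathfrak d_p^{\mathrm{vis}}$ are the limits as $X\to\infty$ of the proportion, among $\mathcal B(\mathscr Y_\Psi;X)$, of globally visible, resp. $p$-adically visible, points. $\mathcal R_X=\{u\in[1,\infty)^r:H(\Psi(u))\le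 X\}$; $V(X)=\mathrm{vol}_r(\mathcal R_X)$; for $1\le j\le r-1$, $V_j(\mathcal R_X)$ is the sum of the $j$-dimensional volumes of the orthogonal projections of $\mathcal R_X$ onto the $j$-dimensional coordinate subspaces of $\mathbb R^r$; $D(X)=\sup_{u\in\mathcal R_X}\min_{1\le i\le r}u_i$. $\zeta$ is the Riemann zeta function. *)

theory Defs
  imports
    "HOL-Analysis.Analysis"
    "HOL-Library.Poly_Mapping"
    "HOL-Library.Landau_Symbols"
    "HOL-Library.Extended_Nat"
    "HOL-Computational_Algebra.Primes"
begin

text \<open>
  Vectors in \<open>\<real>\<^sup>n\<close> are functions \<^typ>\<open>nat \<Rightarrow> real\<close> whose coordinates are indexed by
  \<open>{1..n}\<close>. Sets of vectors that are counted or measured consist of functions extensional on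
  \<open>{1..n}\<close>, so that each vector is represented exactly once.
\<close>

section \<open>Integer polynomials in the variables \<open>X\<^sub>1, \<dots>, X\<^sub>r\<close>\<close>

text \<open>A monomial maps each variable index to its exponent; a polynomial maps each monomial to its
  coefficient.\<close>

type_synonym int_mpoly = "(nat \<Rightarrow>\<^sub>0 nat) \<Rightarrow>\<^sub>0 int"

definition monom_degree :: "(nat \<Rightarrow>\<^sub>0 nat) \<Rightarrow> nat" where
  "monom_degree m = (\<Sum>i\<in>Poly_Mapping.keys m. Poly_Mapping.lookup m i)"

definition mpoly_vars :: "int_mpoly \<Rightarrow> nat set" where
  "mpoly_vars f = (\<Union>m\<in>Poly_Mapping.keys f. Poly_Mapping.keys m)"

definition homogeneous :: "nat \<Rightarrow> int_mpoly \<Rightarrow> bool" where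
  "homogeneous d f \<longleftrightarrow> (\<forall>m\<in>Poly_Mapping.keys f. monom_degree m = d)"

definition nonneg_coeffs :: "int_mpoly \<Rightarrow> bool" where
  "nonneg_coeffs f \<longleftrightarrow> (\<forall>m. 0 \<le> Poly_Mapping.lookup f m)"

definition mpoly_eval :: "int_mpoly \<Rightarrow> (nat \<Rightarrow> real) \<Rightarrow> real" where
  "mpoly_eval f x = (\<Sum>m\<in>Poly_Mapping.keys f. of_int (Poly_Mapping.lookup f m) * (\<Prod>i\<in>Poly_Mapping.keys m. x i ^ Poly_Mapping.lookup m i))"

section \<open>The graph map and its radial branches\<close>

definition graph_map :: "nat \<Rightarrow> nat \<Rightarrow> (nat \<Rightarrow> int_mpoly) \<Rightarrow> (nat \<Rightarrow> real) \<Rightarrow> (nat \<Rightarrow> real)" where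
  "graph_map r s F x = (\<lambda>i\<in>{1..r + s}. if i \<le> r then x i else mpoly_eval (F (i - r)) x)"

text \<open>The parameter is \<open>a = (a\<^sub>2, \<dots>, a\<^sub>r)\<close>; the first coordinate of the base point is \<open>t\<close> itself.\<close>

definition radial_branch ::
    "nat \<Rightarrow> nat \<Rightarrow> (nat \<Rightarrow> int_mpoly) \<Rightarrow> (nat \<Rightarrow> real) \<Rightarrow> real \<Rightarrow> (nat \<Rightarrow> real)" where
  "radial_branch r s F a t = graph_map r s F (\<lambda>i\<in>{1..r}. if i = 1 then t else a i * t)"

definition radial_graph_family ::
    "nat \<Rightarrow> nat \<Rightarrow> (nat \<Rightarrow> int_mpoly) \<Rightarrow> (real \<Rightarrow> nat \<Rightarrow> real) set" where
  "radial_graph_family r s F = radial_branch r s F ` ({2..r} \<rightarrow>\<^sub>E {q \<in> \<rat>. 0 < q})"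

section \<open>Branch points and visibility\<close>

text \<open>Below, \<open>n\<close> is the dimension of the ambient space and \<open>Y\<close> a family of branches in it,
  each of them considered for parameters \<open>t > 0\<close> only.\<close>

definition integral_point :: "nat \<Rightarrow> (nat \<Rightarrow> real) \<Rightarrow> bool" where
  "integral_point n P \<longleftrightarrow> (\<forall>i\<in>{1..n}. P i \<in> \<int>)"

definition height :: "nat \<Rightarrow> (nat \<Rightarrow> real) \<Rightarrow> real" where
  "height n P = Max ((\<lambda>i. \<bar>P i\<bar>) ` {1..n})"

text \<open>The library has \<open>multiplicity p 0 = 0\<close>, whereas \<open>v\<^sub>p(0) = \<infinity>\<close>.\<close>

definition int_val :: "nat \<Rightarrow> int \<Rightarrow> enat" where
  "int_val p k = (if k = 0 then \<infinity> else enat (multiplicity (int p) k))"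

text \<open>Meaningful for integral points only, where the floor is the coordinate itself.\<close>

definition point_val :: "nat \<Rightarrow> nat \<Rightarrow> (nat \<Rightarrow> real) \<Rightarrow> enat" where
  "point_val n p P = Min ((\<lambda>i. int_val p \<lfloor>P i\<rfloor>) ` {1..n})"

definition branch_locus :: "nat \<Rightarrow> (real \<Rightarrow> nat \<Rightarrow> real) set \<Rightarrow> (nat \<Rightarrow> real) set" where
  "branch_locus n Y = {\<phi> t |\<phi> t. \<phi> \<in> Y \<and> 0 < t \<and> integral_point n (\<phi> t)}"

definition globally_visible :: "nat \<Rightarrow> (real \<Rightarrow> nat \<Rightarrow> real) set \<Rightarrow> (nat \<Rightarrow> real) \<Rightarrow> bool" where
  "globally_visible n Y P \<longleftrightarrow>
     (\<exists>\<phi>\<in>Y. \<exists>t>0. P = \<phi> t \<and> integral_point n (\<phi> t) \<and>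
        \<not> (\<exists>u. 0 < u \<and> u < t \<and> integral_point n (\<phi> u)))"

definition padically_visible ::
    "nat \<Rightarrow> (real \<Rightarrow> nat \<Rightarrow> real) set \<Rightarrow> nat \<Rightarrow> (nat \<Rightarrow> real) \<Rightarrow> bool" where
  "padically_visible n Y p P \<longleftrightarrow>
     (\<exists>\<phi>\<in>Y. \<exists>t>0. P = \<phi> t \<and> integral_point n (\<phi> t) \<and>
        (\<forall>u. 0 < u \<and> u < t \<and> integral_point n (\<phi> u) \<longrightarrow>
           point_val n p (\<phi> t) \<le> point_val n p (\<phi> u)))"

definition branch_points_upto ::
    "nat \<Rightarrow> (real \<Rightarrow> nat \<Rightarrow> real) set \<Rightarrow> real \<Rightarrow> (nat \<Rightarrow> real) set" where
  "branch_points_upto n Y X = {P \<in> branch_locus n Y. height n P \<le> X}"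

definition visible_points_upto ::
    "nat \<Rightarrow> (real \<Rightarrow> nat \<Rightarrow> real) set \<Rightarrow> real \<Rightarrow> (nat \<Rightarrow> real) set" where
  "visible_points_upto n Y X = {P \<in> branch_points_upto n Y X. globally_visible n Y P}"

definition padically_visible_points_upto ::
    "nat \<Rightarrow> (real \<Rightarrow> nat \<Rightarrow> real) set \<Rightarrow> nat \<Rightarrow> real \<Rightarrow> (nat \<Rightarrow> real) set" where
  "padically_visible_points_upto n Y p X = {P \<in> branch_points_upto n Y X. padically_visible n Y p P}"

definition visible_proportion :: "nat \<Rightarrow> (real \<Rightarrow> nat \<Rightarrow> real) set \<Rightarrow> real \<Rightarrow> real" where
  "visible_proportion n Y X =
     real (card (visible_points_upto n Y X)) / real (card (branch_points_upto n Y X))"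

definition padic_visible_proportion ::
    "nat \<Rightarrow> (real \<Rightarrow> nat \<Rightarrow> real) set \<Rightarrow> nat \<Rightarrow> real \<Rightarrow> real" where
  "padic_visible_proportion n Y p X =
     real (card (padically_visible_points_upto n Y p X)) / real (card (branch_points_upto n Y X))"

text \<open>The densities are limits. \<^const>\<open>Lim\<close> returns an unspecified value when the limit does not
  exist, so existence has to be asserted separately.\<close>

definition visible_density :: "nat \<Rightarrow> (real \<Rightarrow> nat \<Rightarrow> real) set \<Rightarrow> real" where
  "visible_density n Y = Lim at_top (visible_proportion n Y)"

definition padic_visible_density :: "nat \<Rightarrow> (real \<Rightarrow> nat \<Rightarrow> real) set \<Rightarrow> nat \<Rightarrow> real" where
  "padic_visible_density n Y p = Lim at_top (padic_visible_proportion n Y p)"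

text \<open>For the radial graph family, a point lies on at most one branch and for at most one
  parameter, so the existential quantifiers in the two visibility notions select the unique
  representation of a branch point.\<close>

lemma radial_branch_inject:
  assumes "r \<ge> 1" "a \<in> {2..r} \<rightarrow>\<^sub>E {q \<in> \<rat>. 0 < q}" "b \<in> {2..r} \<rightarrow>\<^sub>E {q \<in> \<rat>. 0 < q}" "0 < t"
    and eq: "radial_branch r s F a t = radial_branch r s F b u"
  shows "a = b" "t = u"
proof -
  have c: "(if i = 1 then t else a i * t) = (if i = 1 then u else b i * u)" if "i \<in> {1..r}" for i
    using fun_cong[OF eq, of i] that by (auto simp: radial_branch_def graph_map_def)
  show tu: "t = u"
    using c[of 1] assms(1) by simp
  show "a = b"
  proof
    fix i
    show "a i = b i"
    proof (cases "i \<in> {2..r}")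
      case True
      then show ?thesis using c[of i] tu assms(4) by simp
    next
      case False
      then show ?thesis using assms(2,3) by (metis PiE_arb)
    qed
  qed
qed

lemma mpoly_eval_cong:
  assumes "mpoly_vars f \<subseteq> A" "\<And>i. i \<in> A \<Longrightarrow> x i = y i"
  shows "mpoly_eval f x = mpoly_eval f y"
  unfolding mpoly_eval_def
  by (intro sum.cong prod.cong arg_cong2[where f = "(*)"] refl)
     (use assms in \<open>auto simp: mpoly_vars_def\<close>)

lemma mpoly_eval_Ints:
  assumes "mpoly_vars f \<subseteq> A" "\<And>i. i \<in> A \<Longrightarrow> x i \<in> \<int>"
  shows "mpoly_eval f x \<in> \<int>"
  unfolding mpoly_eval_def
proof (intro Ints_sum Ints_mult Ints_of_int)
  fix m assume "m \<in> Poly_Mapping.keys f"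
  then have "x i \<in> \<int>" if "i \<in> Poly_Mapping.keys m" for i
    using that assms by (auto simp: mpoly_vars_def)
  then show "(\<Prod>i\<in>Poly_Mapping.keys m. x i ^ Poly_Mapping.lookup m i) \<in> \<int>"
    by (intro Ints_prod Ints_power) auto
qed

lemma graph_map_cong:
  assumes "\<And>j. j \<in> {1..s} \<Longrightarrow> mpoly_vars (F j) \<subseteq> {1..r}" "\<And>i. i \<in> {1..r} \<Longrightarrow> x i = y i"
  shows "graph_map r s F x = graph_map r s F y"
proof
  fix i
  have "mpoly_eval (F (i - r)) x = mpoly_eval (F (i - r)) y" if "i \<in> {1..r + s}" "\<not> i \<le> r"
    by (rule mpoly_eval_cong[OF assms(1)]) (use that assms(2) in auto)
  then show "graph_map r s F x i = graph_map r s F y i"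
    using assms(2) by (auto simp: graph_map_def restrict_def)
qed

lemma branch_locus_radial_graph_family:
  assumes "r \<ge> 1" and vars: "\<And>j. j \<in> {1..s} \<Longrightarrow> mpoly_vars (F j) \<subseteq> {1..r}"
  shows "branch_locus (r + s) (radial_graph_family r s F) =
    {graph_map r s F (\<lambda>i. of_int (x i)) |x :: nat \<Rightarrow> int. \<forall>i\<in>{1..r}. x i \<ge> 1}" (is "?L = ?R")
proof
  show "?L \<subseteq> ?R"
  proof
    fix P assume "P \<in> ?L"
    then obtain a t where a: "a \<in> {2..r} \<rightarrow>\<^sub>E {q \<in> \<rat>. 0 < q}" and t: "0 < t"
      and P: "P = radial_branch r s F a t" and int: "integral_point (r + s) P"
      by (auto simp: branch_locus_def radial_graph_family_def)
    define y where "y = (\<lambda>i\<in>{1..r}. if i = 1 then t else a i * t)"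
    have Py: "P = graph_map r s F y"
      by (simp add: P radial_branch_def y_def)
    have yint: "y i \<in> \<int>" if "i \<in> {1..r}" for i
    proof -
      have "P i \<in> \<int>" using int that by (auto simp: integral_point_def)
      moreover have "P i = y i" using that by (simp add: Py graph_map_def)
      ultimately show ?thesis by simp
    qed
    have ypos: "y i > 0" if "i \<in> {1..r}" for i
      using that t PiE_mem[OF a, of i] by (auto simp: y_def)
    have yfl: "y i = of_int \<lfloor>y i\<rfloor>" if "i \<in> {1..r}" for i
      using yint[OF that] by (auto elim: Ints_cases)
    have "P = graph_map r s F (\<lambda>i. of_int \<lfloor>y i\<rfloor>)"
      unfolding Py by (rule graph_map_cong[OF vars yfl])
    moreover have "\<lfloor>y i\<rfloor> \<ge> 1" if "i \<in> {1..r}" for i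
      using yfl[OF that] ypos[OF that] by linarith
    ultimately show "P \<in> ?R" by (intro CollectI exI[of _ "\<lambda>i. \<lfloor>y i\<rfloor>"]) auto
  qed
  show "?R \<subseteq> ?L"
  proof
    fix P assume "P \<in> ?R"
    then obtain x :: "nat \<Rightarrow> int" where x: "\<And>i. i \<in> {1..r} \<Longrightarrow> x i \<ge> 1"
      and P: "P = graph_map r s F (\<lambda>i. of_int (x i))" by blast
    define a where "a = (\<lambda>i\<in>{2..r}. real_of_int (x i) / of_int (x 1))"
    have x1: "x 1 \<ge> 1" using x[of 1] assms(1) by simp
    have a: "a \<in> {2..r} \<rightarrow>\<^sub>E {q \<in> \<rat>. 0 < q}"
    proof (rule PiE_I)
      fix i assume i: "i \<in> {2..r}"
      then have "x i \<ge> 1" using x[of i] by simp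
      then show "a i \<in> {q \<in> \<rat>. 0 < q}" using i x1 by (auto simp: a_def)
    qed (auto simp: a_def)
    have "P = radial_branch r s F a (of_int (x 1))"
      unfolding P radial_branch_def
      by (rule graph_map_cong[OF vars]) (use x1 in \<open>auto simp: a_def\<close>)
    moreover have "P i \<in> \<int>" if "i \<in> {1..r + s}" for i
    proof (cases "i \<le> r")
      case False
      then have "mpoly_eval (F (i - r)) (\<lambda>i. of_int (x i)) \<in> \<int>"
        using that by (intro mpoly_eval_Ints[OF vars]) auto
      then show ?thesis using that False by (simp add: P graph_map_def)
    qed (use that in \<open>simp add: P graph_map_def\<close>)
    ultimately show "P \<in> ?L"
      using a x1 unfolding branch_locus_def radial_graph_family_def integral_point_def
      by (intro CollectI exI[of _ "radial_branch r s F a"] exI[of _ "real_of_int (x 1)"]) auto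
  qed
qed

section \<open>The counting region\<close>

definition region :: "nat \<Rightarrow> nat \<Rightarrow> (nat \<Rightarrow> int_mpoly) \<Rightarrow> real \<Rightarrow> (nat \<Rightarrow> real) set" where
  "region r s F X = {u \<in> {1..r} \<rightarrow>\<^sub>E {1..}. height (r + s) (graph_map r s F u) \<le> X}"

definition region_volume :: "nat \<Rightarrow> nat \<Rightarrow> (nat \<Rightarrow> int_mpoly) \<Rightarrow> real \<Rightarrow> real" where
  "region_volume r s F X = measure (Pi\<^sub>M {1..r} (\<lambda>_. lborel)) (region r s F X)"

text \<open>The coordinate subspace belonging to a set \<open>J\<close> of coordinates is \<open>\<real>\<^sup>J\<close>, and restriction
  to \<open>J\<close> is the orthogonal projection onto it.\<close>

definition projection_volume :: "nat \<Rightarrow> nat \<Rightarrow> (nat \<Rightarrow> int_mpoly) \<Rightarrow> nat \<Rightarrow> real \<Rightarrow> real" where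
  "projection_volume r s F j X =
     (\<Sum>J | J \<subseteq> {1..r} \<and> card J = j.
        measure (Pi\<^sub>M J (\<lambda>_. lborel)) ((\<lambda>u. restrict u J) ` region r s F X))"

definition region_depth :: "nat \<Rightarrow> nat \<Rightarrow> (nat \<Rightarrow> int_mpoly) \<Rightarrow> real \<Rightarrow> real" where
  "region_depth r s F X = (SUP u\<in>region r s F X. Min (u ` {1..r}))"

text \<open>The Riemann zeta function on real arguments \<open>x > 1\<close>, given there by its Dirichlet series.\<close>

definition real_zeta :: "real \<Rightarrow> real" where
  "real_zeta x = suminf (\<lambda>k. 1 / real (Suc k) powr x)"

end

theory Submission
  imports Defs
begin

text \<open>
  A branch point is \<open>\<Psi>(x)\<close> for a unique positive integral \<open>x\<close>, it lies on one branch only, and the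
  other points of that branch are \<open>\<Psi>(l x)\<close> with \<open>l > 0\<close>. The point \<open>\<Psi>(l x)\<close> is integral exactly when
  \<open>l x\<close> is. So \<open>\<Psi>(x)\<close> is globally visible iff no \<open>l x\<close> with \<open>0 < l < 1\<close> is integral, that is, iff \<open>x\<close>
  is primitive. If \<open>p\<close> divides \<open>x\<close>, then homogeneity of positive degree shows that passing to \<open>x / p\<close>
  lowers the valuation of every coordinate; if it does not, the valuation is \<open>0\<close>
  (\<open>globally_visible_iff_Gcd\<close>, \<open>padically_visible_iff_not_dvd\<close>).

  It remains to count positive integral points in the region \<open>\<R>\<^sub>X\<close>, which is down-closed inside
  \<open>[1, \<infinity>)\<^sup>r\<close> since the coefficients are nonnegative. For such a region, cubes below the points of the
  lattice scaled by \<open>d\<close> give at most \<open>\<Sum>\<^sub>J vol\<^sub>J / d\<^sup>|\<^sup>J\<^sup>|\<close> points, where \<open>vol\<^sub>J\<close> is the volume of the projection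
  to the coordinates in \<open>J\<close> (\<open>card_lattice_points_le\<close>), and division with remainder gives a lower bound
  with the same main term \<open>V / d\<^sup>r\<close> (\<open>card_lattice_points_ge\<close>).

  Sieving by finitely many primes \<open>p\<close> multiplies the density by the factors \<open>1 - p\<^sup>-\<^sup>r\<close>, because the
  multiples of \<open>p\<close> are the points at a scale larger by the factor \<open>p\<close> (\<open>sieved_points_tendsto\<close>). What
  the primes up to \<open>y\<close> fail to remove are multiples of some \<open>d\<close> with \<open>y < d\<close>, where \<open>d\<close> is at most the
  depth \<open>D\<close>. Summing the upper bound over these \<open>d\<close> gives a tail of the zeta series times \<open>V\<close>, plus an
  error in which the empty projection is counted about \<open>D\<close> times, the one-dimensional ones pick up a
  harmonic sum of size \<open>log D\<close>, and the others converge: this is the quantity assumed to be \<open>o(V)\<close>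
  (\<open>sum_card_lattice_points_le\<close>). Letting \<open>y\<close> grow yields the density \<open>\<Prod>\<^sub>p (1 - p\<^sup>-\<^sup>r)\<close>, which is \<open>1 / \<zeta>(r)\<close> by
  the Euler product (\<open>primitive_points_tendsto\<close>, \<open>euler_product_has_prod\<close>).
\<close>

section \<open>The Euler product\<close>

lemma summable_inverse_power:
  assumes "r \<ge> 2"
  shows "summable (\<lambda>k. 1 / real k ^ r)"
  using inverse_power_summable[OF assms, where 'a = real] by (simp add: field_simps)

lemma has_sum_real_zeta:
  assumes "r \<ge> 2"
  shows "((\<lambda>k. 1 / real k ^ r) has_sum real_zeta (real r)) {1..}"
proof -
  have "(\<lambda>k. 1 / real (Suc k) ^ r) sums real_zeta (real r)"
    using summable_inverse_power[OF assms]
    by (subst (asm) summable_Suc_iff[symmetric])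
       (simp add: real_zeta_def powr_realpow summable_sums_iff)
  then have "((\<lambda>k. 1 / real (Suc k) ^ r) has_sum real_zeta (real r)) UNIV"
    by (rule sums_nonneg_imp_has_sum) simp
  then have "((\<lambda>k. 1 / real k ^ r) has_sum real_zeta (real r)) (range Suc)"
    by (subst has_sum_reindex) (auto simp: o_def)
  also have "range Suc = {1..}"
    by (auto simp: image_iff) (metis Suc_le_D)
  finally show ?thesis .
qed

text \<open>Removing the multiples of one more prime \<open>p\<close> from the range of summation removes a copy
  of the remaining series scaled by \<open>p\<^sup>-\<^sup>r\<close>.\<close>

lemma has_sum_zeta_coprime:
  assumes "r \<ge> 2" "finite S" "\<And>p. p \<in> S \<Longrightarrow> prime p"
  shows "((\<lambda>k. 1 / real k ^ r) has_sum (real_zeta (real r) * (\<Prod>p\<in>S. 1 - 1 / real p ^ r)))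
           {k. k \<ge> 1 \<and> (\<forall>p\<in>S. \<not> p dvd k)}"
  using assms(2,3)
proof (induction S rule: finite_induct)
  case empty
  have "{k::nat. k \<ge> 1} = {1..}" by auto
  then show ?case using has_sum_real_zeta[OF assms(1)] by simp
next
  case (insert p S)
  let ?A = "{k::nat. k \<ge> 1 \<and> (\<forall>q\<in>S. \<not> q dvd k)}"
  let ?z = "real_zeta (real r) * (\<Prod>p\<in>S. 1 - 1 / real p ^ r)"
  have p: "prime p" and S: "\<And>q. q \<in> S \<Longrightarrow> prime q" using insert.prems by auto
  have sum: "((\<lambda>k. 1 / real k ^ r) has_sum ?z) ?A" using insert.IH S by auto
  have multiples: "(*) p ` ?A = {k \<in> ?A. p dvd k}"
  proof (intro equalityI subsetI)
    fix m assume "m \<in> (*) p ` ?A"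
    then obtain k where k: "m = p * k" "k \<in> ?A" by auto
    have "\<not> q dvd m" if "q \<in> S" for q
    proof
      assume "q dvd m"
      then have "q dvd p" using k S[OF that] that by (auto simp: prime_dvd_mult_iff)
      then have "q = p" using S[OF that] p primes_dvd_imp_eq by blast
      then show False using that insert.hyps by simp
    qed
    then show "m \<in> {k \<in> ?A. p dvd k}" using k p by (auto simp: Suc_le_eq prime_gt_0_nat)
  next
    fix m assume m: "m \<in> {k \<in> ?A. p dvd k}"
    then obtain k where k: "m = p * k" by auto
    then have "k \<in> ?A" using m by (auto simp: Suc_le_eq)
    then show "m \<in> (*) p ` ?A" using k by auto
  qed
  have "((\<lambda>k. 1 / real (p * k) ^ r) has_sum (1 / real p ^ r * ?z)) ?A"
    using has_sum_cmult_right[OF sum, of "1 / real p ^ r"] by (simp add: power_mult_distrib)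
  then have "((\<lambda>k. 1 / real k ^ r) has_sum (1 / real p ^ r * ?z)) ((*) p ` ?A)"
    using p by (subst has_sum_reindex) (auto simp: inj_on_def o_def)
  then have "((\<lambda>k. 1 / real k ^ r) has_sum (?z - 1 / real p ^ r * ?z)) (?A - (*) p ` ?A)"
    using sum by (intro has_sum_Diff) (unfold multiples, auto)
  moreover have "?A - (*) p ` ?A = {k. k \<ge> 1 \<and> (\<forall>q\<in>insert p S. \<not> q dvd k)}"
    unfolding multiples by auto
  moreover have "?z - 1 / real p ^ r * ?z = real_zeta (real r) * (\<Prod>p\<in>insert p S. 1 - 1 / real p ^ r)"
    using insert.hyps by (simp add: algebra_simps)
  ultimately show ?case by simp
qed

text \<open>Once all primes up to \<open>n\<close> are removed, only \<open>k = 1\<close> and terms with \<open>k > n\<close> survive, so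
  the series is squeezed to \<open>1\<close>.\<close>

lemma euler_product_tendsto:
  assumes "r \<ge> 2"
  shows "(\<lambda>n. \<Prod>p | prime p \<and> p \<le> n. 1 - 1 / real p ^ r) \<longlonglongrightarrow> 1 / real_zeta (real r)"
    and "real_zeta (real r) \<noteq> 0"
proof -
  let ?f = "\<lambda>k::nat. 1 / real k ^ r" and ?z = "real_zeta (real r)"
  define P where "P n = (\<Prod>p | prime p \<and> p \<le> n. 1 - 1 / real p ^ r)" for n :: nat
  have fin: "finite {p. prime p \<and> p \<le> n}" for n :: nat
    by (rule finite_subset[of _ "{..n}"]) auto
  have sums: "(?f has_sum (?z * P n)) {k. k \<ge> 1 \<and> (\<forall>p\<in>{p. prime p \<and> p \<le> n}. \<not> p dvd k)}" for n
    unfolding P_def by (rule has_sum_zeta_coprime[OF assms fin]) auto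
  have lower: "1 \<le> ?z * P n" for n
  proof -
    have "sum ?f {1} \<le> ?z * P n"
      by (rule finite_sum_le_has_sum[OF sums]) (auto dest: not_prime_unit)
    then show ?thesis by simp
  qed
  have upper: "?z * P n \<le> 1 + (?z - sum ?f {1..n})" if "n \<ge> 1" for n
  proof -
    have "(?f has_sum (?z - sum ?f {2..n})) ({1..} - {2..n})"
      by (intro has_sum_Diff has_sum_real_zeta assms has_sum_finite) auto
    moreover have "{k. k \<ge> 1 \<and> (\<forall>p\<in>{p. prime p \<and> p \<le> n}. \<not> p dvd k)} \<subseteq> {1..} - {2..n}"
    proof (intro subsetI DiffI)
      fix k assume k: "k \<in> {k. k \<ge> 1 \<and> (\<forall>p\<in>{p. prime p \<and> p \<le> n}. \<not> p dvd k)}"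
      show "k \<notin> {2..n}"
      proof
        assume "k \<in> {2..n}"
        then obtain p where "prime p" "p dvd k" using prime_factor_nat[of k] by auto
        moreover from this have "p \<le> n" using \<open>k \<in> {2..n}\<close> dvd_imp_le[of p k] by auto
        ultimately show False using k by auto
      qed
    qed auto
    ultimately have "?z * P n \<le> ?z - sum ?f {2..n}"
      by (rule has_sum_mono2[OF sums]) auto
    moreover have "sum ?f {1..n} = 1 + sum ?f {2..n}"
      using that by (simp add: sum.atLeast_Suc_atMost numeral_2_eq_2)
    ultimately show ?thesis by simp
  qed
  have "(\<lambda>n. sum ?f {..<n}) \<longlonglongrightarrow> suminf ?f"
    using summable_inverse_power[OF assms] by (rule summable_LIMSEQ)
  moreover have "suminf ?f = ?z"
  proof -
    have "suminf ?f = suminf (\<lambda>k. ?f (Suc k)) + ?f 0"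
      using suminf_split_head[OF summable_inverse_power[OF assms]] by simp
    then show ?thesis using assms by (simp add: real_zeta_def powr_realpow)
  qed
  ultimately have "(\<lambda>n. sum ?f {..<n}) \<longlonglongrightarrow> ?z" by simp
  then have "(\<lambda>n. sum ?f {..<Suc n}) \<longlonglongrightarrow> ?z" by (rule LIMSEQ_Suc)
  moreover have "sum ?f {..<Suc n} = sum ?f {1..n}" for n
  proof -
    have "{..<Suc n} = insert 0 {1..n}" by auto
    then show ?thesis using assms by simp
  qed
  ultimately have lim_sum: "(\<lambda>n. sum ?f {1..n}) \<longlonglongrightarrow> ?z" by simp
  have lim: "(\<lambda>n. ?z * P n) \<longlonglongrightarrow> 1"
  proof (rule tendsto_sandwich)
    show "eventually (\<lambda>n. 1 \<le> ?z * P n) sequentially" by (intro always_eventually allI lower)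
    show "eventually (\<lambda>n. ?z * P n \<le> 1 + (?z - sum ?f {1..n})) sequentially"
      by (rule eventually_sequentiallyI[of 1]) (rule upper)
    show "(\<lambda>n. 1 + (?z - sum ?f {1..n})) \<longlonglongrightarrow> 1"
      using tendsto_add[OF tendsto_const tendsto_diff[OF tendsto_const lim_sum], of 1 ?z] by simp
  qed simp
  show nz: "?z \<noteq> 0" using lower[of 0] by auto
  show "(\<lambda>n. \<Prod>p | prime p \<and> p \<le> n. 1 - 1 / real p ^ r) \<longlonglongrightarrow> 1 / ?z"
    using tendsto_divide[OF lim tendsto_const[of ?z] nz] nz unfolding P_def by simp
qed

lemma euler_product_has_prod:
  assumes "r \<ge> 2"
  shows "(\<lambda>p. if prime p then 1 - 1 / real p ^ r else 1) has_prod (1 / real_zeta (real r))"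
proof -
  define f where "f p = (if prime p then 1 - 1 / real p ^ r else 1)" for p :: nat
  have "prod f {..n} = (\<Prod>p | prime p \<and> p \<le> n. 1 - 1 / real p ^ r)" for n
    unfolding f_def by (rule prod.mono_neutral_cong_right) auto
  then have "f has_prod (1 / real_zeta (real r))"
    using euler_product_tendsto[OF assms] by (simp add: has_prod_def raw_has_prod_def)
  then show ?thesis unfolding f_def .
qed

section \<open>Lattice points in down-closed regions\<close>

text \<open>The elements are the points \<open>x\<close> and not the points \<open>d x\<close> of the region, so that passing to
  multiples of a prime \<open>p\<close> just replaces the scale \<open>d\<close> by \<open>d p\<close>.\<close>

definition lattice_points :: "'i set \<Rightarrow> ('i \<Rightarrow> real) set \<Rightarrow> nat \<Rightarrow> ('i \<Rightarrow> int) set" where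
  "lattice_points I R d = {x \<in> I \<rightarrow>\<^sub>E {1..}. (\<lambda>i\<in>I. real d * of_int (x i)) \<in> R}"

definition shadow_volume :: "('i \<Rightarrow> real) set \<Rightarrow> 'i set \<Rightarrow> real" where
  "shadow_volume R J = measure (Pi\<^sub>M J (\<lambda>_. lborel)) ((\<lambda>u. restrict u J) ` R)"

definition depth :: "'i set \<Rightarrow> ('i \<Rightarrow> real) set \<Rightarrow> real" where
  "depth I R = (SUP u\<in>R. Min (u ` I))"

text \<open>The set \<open>J = {}\<close> takes part in this sum: its shadow is a single point, of measure \<open>1\<close>, and
  it accounts for the lattice point \<open>(1, \<dots>, 1)\<close>.\<close>

definition boundary_volume :: "'i set \<Rightarrow> ('i \<Rightarrow> real) set \<Rightarrow> real" where
  "boundary_volume I R = (\<Sum>J\<in>Pow I - {I}. shadow_volume R J)"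

definition sieved_points :: "'i set \<Rightarrow> ('i \<Rightarrow> real) set \<Rightarrow> nat set \<Rightarrow> nat \<Rightarrow> ('i \<Rightarrow> int) set" where
  "sieved_points I R S d = {x \<in> lattice_points I R d. \<forall>p\<in>S. \<not> (\<forall>i\<in>I. int p dvd x i)}"

text \<open>Down-closedness is relative to \<open>[1, \<infinity>)\<^sup>I\<close>, where the positive lattice points live. The bound
  \<open>B\<close> makes the counts and volumes finite.\<close>

locale down_region =
  fixes I :: "'i set" and R :: "('i \<Rightarrow> real) set" and B :: real
  assumes finite_I: "finite I"
    and bounded: "R \<subseteq> I \<rightarrow>\<^sub>E {1..B}"
    and down_closed: "\<And>u w. u \<in> R \<Longrightarrow> w \<in> I \<rightarrow>\<^sub>E {1..} \<Longrightarrow> (\<And>i. i \<in> I \<Longrightarrow> w i \<le> u i) \<Longrightarrow> w \<in> R"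
    and shadow_sets: "\<And>J. J \<subseteq> I \<Longrightarrow> (\<lambda>u. restrict u J) ` R \<in> sets (Pi\<^sub>M J (\<lambda>_. lborel))"
begin

interpretation lborels: product_sigma_finite "\<lambda>_::'i. lborel :: real measure"
  by standard

lemma box_fmeasurable:
  fixes J :: "'i set"
  assumes "finite J" "\<And>i. i \<in> J \<Longrightarrow> A i \<in> sets borel" "\<And>i. i \<in> J \<Longrightarrow> bounded (A i)"
  shows "Pi\<^sub>E J A \<in> fmeasurable (Pi\<^sub>M J (\<lambda>_. lborel :: real measure))"
proof (rule fmeasurableI)
  show "Pi\<^sub>E J A \<in> sets (Pi\<^sub>M J (\<lambda>_. lborel))"
    using assms by (intro sets_PiM_I_finite) auto
  have "emeasure (Pi\<^sub>M J (\<lambda>_. lborel)) (Pi\<^sub>E J A) = (\<Prod>i\<in>J. emeasure lborel (A i))"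
    using assms by (intro lborels.emeasure_PiM) auto
  also have "\<dots> < \<infinity>"
    using emeasure_bounded_finite[OF assms(3)]
    by (auto simp: ennreal_prod_eq_top simp flip: less_top)
  finally show "emeasure (Pi\<^sub>M J (\<lambda>_. lborel)) (Pi\<^sub>E J A) < \<infinity>" .
qed

lemma measure_cube:
  fixes a b :: "'i \<Rightarrow> real" and J :: "'i set"
  assumes "finite J" "\<And>i. i \<in> J \<Longrightarrow> b i = a i + c" "c \<ge> 0"
  shows "measure (Pi\<^sub>M J (\<lambda>_. lborel)) (Pi\<^sub>E J (\<lambda>i. {a i..<b i})) = c ^ card J"
proof -
  have "emeasure (Pi\<^sub>M J (\<lambda>_. lborel)) (Pi\<^sub>E J (\<lambda>i. {a i..<b i})) = (\<Prod>i\<in>J. emeasure lborel {a i..<b i})"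
    using assms by (intro lborels.emeasure_PiM) auto
  also have "\<dots> = (\<Prod>i\<in>J. ennreal c)"
    using assms by (intro prod.cong) auto
  also have "\<dots> = ennreal (c ^ card J)"
    using assms by (simp add: ennreal_power)
  finally show ?thesis using assms by (simp add: measure_def)
qed

lemma shadow_fmeasurable:
  assumes "J \<subseteq> I"
  shows "(\<lambda>u. restrict u J) ` R \<in> fmeasurable (Pi\<^sub>M J (\<lambda>_. lborel))"
proof (rule fmeasurableI2)
  show "Pi\<^sub>E J (\<lambda>_. {1..B}) \<in> fmeasurable (Pi\<^sub>M J (\<lambda>_. lborel))"
    using finite_subset[OF assms finite_I]
    by (intro box_fmeasurable) auto
  show "(\<lambda>u. restrict u J) ` R \<subseteq> Pi\<^sub>E J (\<lambda>_. {1..B})"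
    using bounded assms by (fastforce simp: PiE_iff)
qed (rule shadow_sets[OF assms])

lemma shadow_volume_nonneg: "shadow_volume R J \<ge> 0"
  by (simp add: shadow_volume_def)

lemma restrict_I: "(\<lambda>u. restrict u I) ` R = R"
proof -
  have "restrict u I = u" if "u \<in> R" for u
    using that bounded by (meson PiE_restrict subsetD)
  then show ?thesis by auto
qed

lemma shadow_volume_empty:
  assumes "R \<noteq> {}"
  shows "shadow_volume R {} = 1"
proof -
  have "(\<lambda>u. restrict u {}) ` R = {\<lambda>_. undefined}"
    using assms by (auto simp: restrict_def image_iff)
  then show ?thesis by (simp add: shadow_volume_def measure_def)
qed

lemma finite_lattice_points:
  assumes "d \<ge> 1"
  shows "finite (lattice_points I R d)"
proof (rule finite_subset)
  show "lattice_points I R d \<subseteq> I \<rightarrow>\<^sub>E {1..\<lfloor>B\<rfloor>}"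
  proof
    fix x assume x: "x \<in> lattice_points I R d"
    then have "(\<lambda>i\<in>I. real d * of_int (x i)) \<in> I \<rightarrow>\<^sub>E {1..B}"
      using bounded unfolding lattice_points_def by blast
    then have "real d * of_int (x i) \<le> B" if "i \<in> I" for i
      using that by (metis (no_types, lifting) PiE_mem atLeastAtMost_iff restrict_apply')
    moreover have "1 * real_of_int (x i) \<le> real d * of_int (x i)" if "i \<in> I" for i
      using that x assms by (intro mult_right_mono) (auto simp: lattice_points_def PiE_iff)
    ultimately have "x i \<le> \<lfloor>B\<rfloor>" if "i \<in> I" for i
      using that by (fastforce simp: le_floor_iff)
    then show "x \<in> I \<rightarrow>\<^sub>E {1..\<lfloor>B\<rfloor>}"
      using x by (auto simp: lattice_points_def PiE_iff)
  qed
  show "finite (I \<rightarrow>\<^sub>E {1..\<lfloor>B\<rfloor>})"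
    using finite_I by (intro finite_PiE) auto
qed

text \<open>The cubes of side \<open>d\<close> in \<open>\<real>\<^sup>J\<close> whose upper corners are the points \<open>d x\<close> are disjoint, because
  the points of a face are determined by their coordinates in \<open>J\<close>. They lie in the shadow, because
  the region is down-closed and \<open>d (x\<^sub>i - 1) \<ge> 1\<close> on \<open>J\<close>; this is why a coordinate equal to \<open>1\<close> has
  to be projected away.\<close>

lemma card_face_le:
  assumes "d \<ge> 1" "J \<subseteq> I"
  shows "real (card {x \<in> lattice_points I R d. {i \<in> I. x i \<ge> 2} = J}) * real d ^ card J
           \<le> shadow_volume R J"
proof -
  let ?M = "Pi\<^sub>M J (\<lambda>_. lborel :: real measure)"
  let ?P = "(\<lambda>u. restrict u J) ` R"
  define face where "face = {x \<in> lattice_points I R d. {i \<in> I. x i \<ge> 2} = J}"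
  define box where "box x = Pi\<^sub>E J (\<lambda>i. {real d * (of_int (x i) - 1)..<real d * of_int (x i)})"
    for x :: "'i \<Rightarrow> int"
  have J: "finite J" using assms(2) finite_I finite_subset by blast
  have fin: "finite face"
    unfolding face_def using finite_lattice_points[OF assms(1)] by auto
  have meas: "box x \<in> fmeasurable ?M" for x
    unfolding box_def
    by (intro box_fmeasurable J) auto
  have vol: "measure ?M (box x) = real d ^ card J" for x
    unfolding box_def by (intro measure_cube J) (auto simp: algebra_simps)
  have off: "x i = 1" if "x \<in> face" "i \<in> I - J" for x i
  proof -
    have "\<not> x i \<ge> 2" using that by (auto simp: face_def)
    moreover have "x i \<ge> 1" using that by (auto simp: face_def lattice_points_def PiE_iff)
    ultimately show ?thesis by simp
  qed
  have disj: "disjoint_family_on box face"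
    unfolding disjoint_family_on_def
  proof (intro ballI impI)
    fix x y assume xy: "x \<in> face" "y \<in> face" "x \<noteq> y"
    show "box x \<inter> box y = {}"
    proof (rule ccontr)
      assume "box x \<inter> box y \<noteq> {}"
      then obtain w where w: "w \<in> box x" "w \<in> box y" by auto
      have le: "a i \<le> b i" if "w \<in> box a" "w \<in> box b" "i \<in> J" for a b i
      proof -
        have "real d * (of_int (a i) - 1) \<le> w i" "w i < real d * of_int (b i)"
          using that by (simp_all add: box_def PiE_iff)
        then have "real d * (of_int (a i) - 1) < real d * of_int (b i)" by linarith
        then have "real_of_int (a i) - 1 < of_int (b i)" using assms(1) by simp
        then show ?thesis by linarith
      qed
      have "x i = y i" if "i \<in> I" for i
      proof (cases "i \<in> J")
        case True
        then show ?thesis using le[OF w True] le[OF w(2,1) True] by simp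
      next
        case False
        then show ?thesis using off[OF xy(1), of i] off[OF xy(2), of i] that by simp
      qed
      moreover have "x \<in> I \<rightarrow>\<^sub>E {1..}" "y \<in> I \<rightarrow>\<^sub>E {1..}"
        using xy by (auto simp: face_def lattice_points_def)
      ultimately have "x = y" by (meson PiE_ext)
      then show False using xy by simp
    qed
  qed
  have sub: "(\<Union>x\<in>face. box x) \<subseteq> ?P"
  proof
    fix w assume "w \<in> (\<Union>x\<in>face. box x)"
    then obtain x where x: "x \<in> face" and w: "w \<in> box x" by auto
    define u where "u = (\<lambda>i\<in>I. if i \<in> J then w i else 1)"
    have xR: "(\<lambda>i\<in>I. real d * of_int (x i)) \<in> R"
      using x by (auto simp: face_def lattice_points_def)
    have ge: "1 \<le> u i" "u i \<le> real d * of_int (x i)" if i: "i \<in> I" for i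
    proof -
      have "1 \<le> u i \<and> u i \<le> real d * of_int (x i)"
      proof (cases "i \<in> J")
        case True
        then have "x i \<ge> 2" using x by (auto simp: face_def)
        then have "1 * 1 \<le> real d * (of_int (x i) - 1)"
          using assms(1) by (intro mult_mono) auto
        then show ?thesis using w True i by (force simp: u_def box_def PiE_iff)
      next
        case False
        then show ?thesis using off[OF x, of i] i assms(1) by (simp add: u_def)
      qed
      then show "1 \<le> u i" "u i \<le> real d * of_int (x i)" by auto
    qed
    have "u \<in> R"
      by (rule down_closed[OF xR]) (use ge in \<open>auto simp: PiE_iff u_def\<close>)
    moreover have "restrict u J = w"
      using w assms(2) by (intro ext) (auto simp: u_def box_def PiE_iff extensional_def)
    ultimately show "w \<in> ?P" by blast
  qed
  have "real (card face) * real d ^ card J = (\<Sum>x\<in>face. measure ?M (box x))"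
    by (simp add: vol)
  also have "\<dots> = measure ?M (\<Union>x\<in>face. box x)"
    by (rule measure_finite_Union[symmetric, OF fin _ disj])
       (use meas in \<open>auto simp: fmeasurable_def less_top[symmetric]\<close>)
  also have "\<dots> \<le> measure ?M ?P"
    by (rule measure_mono_fmeasurable[OF sub _ shadow_fmeasurable[OF assms(2)]])
       (use meas fin in \<open>auto simp: fmeasurable_def\<close>)
  finally show ?thesis by (simp add: face_def shadow_volume_def)
qed

text \<open>Summing over the faces, each coordinate set \<open>J\<close> contributes with its own power of \<open>d\<close>. This decay
  in \<open>d\<close> is what keeps the error small when the bound is later summed over many scales.\<close>

lemma card_lattice_points_le:
  assumes "d \<ge> 1"
  shows "real (card (lattice_points I R d)) \<le> (\<Sum>J\<in>Pow I. shadow_volume R J / real d ^ card J)"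
proof -
  let ?face = "\<lambda>J. {x \<in> lattice_points I R d. {i \<in> I. x i \<ge> 2} = J}"
  have "x \<in> ?face {i \<in> I. x i \<ge> 2}" if "x \<in> lattice_points I R d" for x
    using that by simp
  then have "lattice_points I R d = (\<Union>J\<in>Pow I. ?face J)" by blast
  then have "card (lattice_points I R d) \<le> (\<Sum>J\<in>Pow I. card (?face J))"
    using card_UN_le[of "Pow I" ?face] finite_I by simp
  then have "real (card (lattice_points I R d)) \<le> (\<Sum>J\<in>Pow I. real (card (?face J)))"
    by (simp flip: of_nat_sum)
  also have "\<dots> \<le> (\<Sum>J\<in>Pow I. shadow_volume R J / real d ^ card J)"
    using card_face_le[OF assms] assms by (intro sum_mono) (auto simp: field_simps)
  finally show ?thesis .
qed

text \<open>A point with some coordinate equal to \<open>1\<close> lies in a face with \<open>J \<noteq> I\<close>, so only shadows of lower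
  dimension are needed.\<close>

lemma card_boundary_le:
  "real (card {x \<in> lattice_points I R 1. \<exists>i\<in>I. x i = 1}) \<le> boundary_volume I R"
proof -
  let ?face = "\<lambda>J. {x \<in> lattice_points I R 1. {i \<in> I. x i \<ge> 2} = J}"
  have sub: "{x \<in> lattice_points I R 1. \<exists>i\<in>I. x i = 1} \<subseteq> (\<Union>J\<in>Pow I - {I}. ?face J)"
  proof
    fix x assume x: "x \<in> {x \<in> lattice_points I R 1. \<exists>i\<in>I. x i = 1}"
    then have "{i \<in> I. x i \<ge> 2} \<noteq> I" by force
    then have "{i \<in> I. x i \<ge> 2} \<in> Pow I - {I}" by blast
    moreover have "x \<in> ?face {i \<in> I. x i \<ge> 2}" using x by simp
    ultimately show "x \<in> (\<Union>J\<in>Pow I - {I}. ?face J)" by blast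
  qed
  have "card {x \<in> lattice_points I R 1. \<exists>i\<in>I. x i = 1} \<le> card (\<Union>J\<in>Pow I - {I}. ?face J)"
    using finite_I finite_lattice_points[of 1] by (intro card_mono[OF _ sub]) auto
  also have "\<dots> \<le> (\<Sum>J\<in>Pow I - {I}. card (?face J))"
    using finite_I by (intro card_UN_le) auto
  finally have "real (card {x \<in> lattice_points I R 1. \<exists>i\<in>I. x i = 1})
      \<le> (\<Sum>J\<in>Pow I - {I}. real (card (?face J)))"
    by (simp flip: of_nat_sum)
  also have "\<dots> \<le> (\<Sum>J\<in>Pow I - {I}. shadow_volume R J)"
    using card_face_le[of 1] by (intro sum_mono) auto
  finally show ?thesis by (simp add: boundary_volume_def)
qed

text \<open>Rounding down maps the region into the lattice points, with fibres inside unit cubes.\<close>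

lemma volume_le_card_lattice_points: "shadow_volume R I \<le> real (card (lattice_points I R 1))"
proof -
  let ?M = "Pi\<^sub>M I (\<lambda>_. lborel :: real measure)"
  define box where "box x = Pi\<^sub>E I (\<lambda>i. {real_of_int (x i)..<real_of_int (x i) + 1})"
    for x :: "'i \<Rightarrow> int"
  have fin: "finite (lattice_points I R 1)" by (rule finite_lattice_points) simp
  have meas: "box x \<in> fmeasurable ?M" for x
    unfolding box_def by (intro box_fmeasurable finite_I) auto
  have vol: "measure ?M (box x) = 1 ^ card I" for x
    unfolding box_def by (intro measure_cube finite_I) auto
  have "R \<subseteq> (\<Union>x\<in>lattice_points I R 1. box x)"
  proof
    fix u assume u: "u \<in> R"
    then have uI: "u \<in> I \<rightarrow>\<^sub>E {1..B}" using bounded by auto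
    define x where "x = (\<lambda>i\<in>I. \<lfloor>u i\<rfloor>)"
    have "(\<lambda>i\<in>I. real 1 * of_int (x i)) \<in> R"
      by (rule down_closed[OF u]) (use uI in \<open>auto simp: x_def PiE_iff\<close>)
    then have "x \<in> lattice_points I R 1"
      using uI by (auto simp: lattice_points_def x_def PiE_iff)
    moreover have "u \<in> box x"
      using uI by (auto simp: box_def x_def PiE_iff)
    ultimately show "u \<in> (\<Union>x\<in>lattice_points I R 1. box x)" by blast
  qed
  then have "measure ?M R \<le> measure ?M (\<Union>x\<in>lattice_points I R 1. box x)"
    using shadow_sets[of I] meas
    by (intro measure_mono_fmeasurable fmeasurable.finite_UN[OF fin]) (simp_all add: restrict_I)
  also have "\<dots> \<le> (\<Sum>x\<in>lattice_points I R 1. measure ?M (box x))"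
    using meas by (intro measure_UNION_le fin) (auto simp: fmeasurable_def)
  finally show ?thesis by (simp add: vol shadow_volume_def restrict_I)
qed

lemma lattice_points_down_closed:
  assumes "x \<in> lattice_points I R 1" "y \<in> I \<rightarrow>\<^sub>E {1..}" "d \<ge> 1"
    "\<And>i. i \<in> I \<Longrightarrow> int d * y i \<le> x i"
  shows "y \<in> lattice_points I R d"
proof -
  have x: "(\<lambda>i\<in>I. real 1 * of_int (x i)) \<in> R"
    using assms(1) by (simp add: lattice_points_def)
  have "(\<lambda>i\<in>I. real d * of_int (y i)) \<in> R"
  proof (rule down_closed[OF x])
    show "(\<lambda>i\<in>I. real d * of_int (y i)) \<in> I \<rightarrow>\<^sub>E {1..}"
    proof
      fix i assume i: "i \<in> I"
      then have "1 * 1 \<le> real d * of_int (y i)"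
        using assms(2,3) by (intro mult_mono) (auto simp: PiE_iff)
      then show "(\<lambda>i\<in>I. real d * of_int (y i)) i \<in> {1..}" using i by simp
    qed auto
    fix i assume i: "i \<in> I"
    have "real_of_int (int d * y i) \<le> real_of_int (x i)"
      using assms(4)[OF i] by (simp only: of_int_le_iff)
    then show "(\<lambda>i\<in>I. real d * of_int (y i)) i \<le> (\<lambda>i\<in>I. real 1 * of_int (x i)) i"
      using i by simp
  qed
  then show ?thesis using assms(2) by (simp add: lattice_points_def)
qed

text \<open>Dividing the coordinates by \<open>d\<close> sends the lattice points that have all coordinates at least
  \<open>d\<close> to those of the scaled lattice, at most \<open>d\<^sup>r\<close> to one. In the remaining points some coordinate
  is smaller than \<open>d\<close>, and lowering it to \<open>1\<close> moves them to the boundary.\<close>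

lemma card_lattice_points_ge:
  assumes "d \<ge> 1"
  shows "shadow_volume R I \<le> real d ^ card I * real (card (lattice_points I R d))
           + real (card I) * real d * boundary_volume I R"
proof -
  let ?L = "lattice_points I R"
  define big where "big = {x \<in> ?L 1. \<forall>i\<in>I. x i \<ge> int d}"
  define small where "small i = {x \<in> ?L 1. x i < int d}" for i
  define bd where "bd = {x \<in> ?L 1. \<exists>i\<in>I. x i = 1}"
  have fin: "finite (?L 1)" "finite (?L d)" using finite_lattice_points assms by auto
  have L: "x \<in> I \<rightarrow>\<^sub>E {1..}" if "x \<in> ?L e" for x e
    using that by (simp add: lattice_points_def)
  have "card big \<le> card (?L d \<times> (I \<rightarrow>\<^sub>E {0..<int d}))"
  proof (rule card_inj_on_le)
    let ?f = "\<lambda>x. (\<lambda>i\<in>I. x i div int d, \<lambda>i\<in>I. x i mod int d)"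
    show "inj_on ?f big"
    proof (rule inj_onI)
      fix x y assume xy: "x \<in> big" "y \<in> big" "?f x = ?f y"
      have "x i = y i" if "i \<in> I" for i
      proof -
        have "x i div int d = y i div int d" "x i mod int d = y i mod int d"
          using xy(3) that by (auto dest!: fun_cong[of _ _ i])
        then show ?thesis by (metis mult_div_mod_eq)
      qed
      moreover have "x \<in> I \<rightarrow>\<^sub>E {1..}" "y \<in> I \<rightarrow>\<^sub>E {1..}" using xy L by (auto simp: big_def)
      ultimately show "x = y" by (meson PiE_ext)
    qed
    show "?f ` big \<subseteq> ?L d \<times> (I \<rightarrow>\<^sub>E {0..<int d})"
    proof (rule image_subsetI)
      fix x assume x: "x \<in> big"
      have "(\<lambda>i\<in>I. x i div int d) \<in> ?L d"
      proof (rule lattice_points_down_closed[of x])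
        show "(\<lambda>i\<in>I. x i div int d) \<in> I \<rightarrow>\<^sub>E {1..}"
        proof
          fix i assume i: "i \<in> I"
          then have "int d div int d \<le> x i div int d"
            using x assms by (intro zdiv_mono1) (auto simp: big_def)
          then show "(\<lambda>i\<in>I. x i div int d) i \<in> {1..}" using i assms by simp
        qed auto
        fix i assume "i \<in> I"
        then show "int d * (\<lambda>i\<in>I. x i div int d) i \<le> x i"
          using assms by (simp add: minus_mod_eq_mult_div[symmetric])
      qed (use x assms in \<open>auto simp: big_def\<close>)
      then show "?f x \<in> ?L d \<times> (I \<rightarrow>\<^sub>E {0..<int d})" using assms by auto
    qed
    show "finite (?L d \<times> (I \<rightarrow>\<^sub>E {0..<int d}))"
      using fin finite_I by (auto intro: finite_PiE)
  qed
  then have big: "card big \<le> d ^ card I * card (?L d)"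
    using finite_I by (simp add: card_cartesian_product card_PiE mult.commute)
  have small: "card (small i) \<le> d * card bd" if i: "i \<in> I" for i
  proof -
    have "card (small i) \<le> card (bd \<times> {0..<int d})"
    proof (rule card_inj_on_le)
      let ?f = "\<lambda>x. (x(i := 1), x i)"
      show "inj_on ?f (small i)"
        by (rule inj_onI) (metis fun_upd_triv fun_upd_upd prod.inject)
      show "?f ` small i \<subseteq> bd \<times> {0..<int d}"
      proof (rule image_subsetI)
        fix x assume x: "x \<in> small i"
        then have xI: "x \<in> I \<rightarrow>\<^sub>E {1..}" "x i < int d" "x \<in> ?L 1" using L by (auto simp: small_def)
        have "x(i := 1) \<in> ?L 1"
          by (rule lattice_points_down_closed[OF xI(3)])
             (use xI i in \<open>auto simp: PiE_iff extensional_def\<close>)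
        moreover have "0 \<le> x i" using xI(1) i by (force simp: PiE_iff)
        ultimately show "?f x \<in> bd \<times> {0..<int d}"
          using xI(2) i by (auto simp: bd_def intro!: bexI[of _ i])
      qed
      show "finite (bd \<times> {0..<int d})" using fin by (auto simp: bd_def)
    qed
    then show ?thesis by (simp add: card_cartesian_product mult.commute)
  qed
  have "?L 1 \<subseteq> big \<union> (\<Union>i\<in>I. small i)" by (auto simp: big_def small_def)
  then have "card (?L 1) \<le> card (big \<union> (\<Union>i\<in>I. small i))"
    using fin finite_I by (intro card_mono) (auto simp: big_def small_def)
  also have "\<dots> \<le> card big + (\<Sum>i\<in>I. card (small i))"
    using card_Un_le[of big "\<Union>i\<in>I. small i"] card_UN_le[OF finite_I, of small] by linarith
  also have "\<dots> \<le> d ^ card I * card (?L d) + (\<Sum>i\<in>I. d * card bd)"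
    by (intro add_mono big sum_mono small)
  finally have "real (card (?L 1)) \<le> real (d ^ card I * card (?L d) + (\<Sum>i\<in>I. d * card bd))"
    by (simp only: of_nat_le_iff)
  also have "\<dots> = real d ^ card I * real (card (?L d)) + real (card I) * real d * real (card bd)"
    by simp
  also have "\<dots> \<le> real d ^ card I * real (card (?L d)) + real (card I) * real d * boundary_volume I R"
    using card_boundary_le unfolding bd_def by (intro add_left_mono mult_left_mono) auto
  finally show ?thesis using volume_le_card_lattice_points by linarith
qed

text \<open>A lattice point \<open>x\<close> has all coordinates at least \<open>1\<close>, so \<open>d x\<close> has all coordinates at least \<open>d\<close>.
  Hence only finitely many scales matter for a given region.\<close>

lemma le_depth:
  assumes "lattice_points I R d \<noteq> {}" "I \<noteq> {}"
  shows "real d \<le> depth I R"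
proof -
  obtain x where x: "x \<in> I \<rightarrow>\<^sub>E {1..}" and u: "(\<lambda>i\<in>I. real d * of_int (x i)) \<in> R" (is "?u \<in> R")
    using assms(1) by (auto simp: lattice_points_def)
  have "Min (u ` I) \<le> B" if "u \<in> R" for u
  proof -
    obtain i where i: "i \<in> I" using assms(2) by auto
    then have "Min (u ` I) \<le> u i" using finite_I by auto
    also have "u i \<le> B" using that bounded i by (auto simp: PiE_iff)
    finally show ?thesis .
  qed
  then have bdd: "bdd_above ((\<lambda>u. Min (u ` I)) ` R)" by (intro bdd_aboveI2)
  have "real d \<le> real d * of_int (x i)" if "i \<in> I" for i
  proof -
    have "1 \<le> real_of_int (x i)" using x that by (auto simp: PiE_iff)
    then show ?thesis using mult_left_mono[of 1 "real_of_int (x i)" "real d"] by simp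
  qed
  then have "real d \<le> Min (?u ` I)"
    using finite_I assms(2) by (subst Min_ge_iff) auto
  also have "\<dots> \<le> depth I R" unfolding depth_def by (rule cSUP_upper[OF u bdd])
  finally show ?thesis .
qed

section \<open>Sieving by primes\<close>

lemma finite_sieved_points:
  assumes "d \<ge> 1"
  shows "finite (sieved_points I R S d)"
  using finite_lattice_points[OF assms] by (simp add: sieved_points_def)

lemma scaled_in_lattice_points_iff:
  assumes "p \<ge> 1" "x \<in> I \<rightarrow>\<^sub>E UNIV"
  shows "(\<lambda>i\<in>I. int p * x i) \<in> lattice_points I R d \<longleftrightarrow> x \<in> lattice_points I R (d * p)"
proof -
  have "(\<lambda>i\<in>I. real d * of_int ((\<lambda>i\<in>I. int p * x i) i)) = (\<lambda>i\<in>I. real (d * p) * of_int (x i))"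
    by auto
  moreover have "(\<lambda>i\<in>I. int p * x i) \<in> I \<rightarrow>\<^sub>E {1..} \<longleftrightarrow> x \<in> I \<rightarrow>\<^sub>E {1..}"
  proof -
    have "1 \<le> int p * x i \<longleftrightarrow> 1 \<le> x i" for i
      using assms(1) by (simp add: int_one_le_iff_zero_less zero_less_mult_iff)
    then show ?thesis using assms(2) by (auto simp: PiE_iff)
  qed
  ultimately show ?thesis by (simp add: lattice_points_def)
qed

text \<open>Multiplication by \<open>p\<close> is a bijection from the sieved points at scale \<open>d p\<close> onto the multiples
  of \<open>p\<close> among the sieved points at scale \<open>d\<close>: it preserves divisibility by the primes in \<open>S\<close>, as
  \<open>p\<close> is not among them. Adding a prime to the sieve therefore costs one count at a larger scale,
  which replaces inclusion and exclusion over all products of primes.\<close>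

lemma card_sieved_points_insert:
  assumes "d \<ge> 1" "prime p" "p \<notin> S" "\<And>q. q \<in> S \<Longrightarrow> prime q"
  shows "card (sieved_points I R (insert p S) d) + card (sieved_points I R S (d * p))
           = card (sieved_points I R S d)"
proof -
  let ?A = "sieved_points I R S d" and ?m = "\<lambda>x. \<lambda>i\<in>I. int p * x i"
  have p: "p \<ge> 1" using assms(2) prime_ge_1_nat by blast
  have dvd: "int q dvd int p * k \<longleftrightarrow> int q dvd k" if "q \<in> S" for q k
  proof -
    have "q \<noteq> p" using that assms(3) by auto
    then have "coprime (int q) (int p)"
      using assms(2,4) that primes_coprime[of q p] by (simp add: coprime_int_iff)
    then show ?thesis by (simp add: coprime_dvd_mult_right_iff)
  qed
  have ext: "x \<in> I \<rightarrow>\<^sub>E UNIV" if "x \<in> lattice_points I R e" for x e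
    using that by (auto simp: lattice_points_def PiE_iff)
  have multiples: "?m ` sieved_points I R S (d * p) = {x \<in> ?A. \<forall>i\<in>I. int p dvd x i}"
  proof (intro equalityI subsetI)
    fix y assume "y \<in> ?m ` sieved_points I R S (d * p)"
    then obtain x where x: "y = ?m x" "x \<in> sieved_points I R S (d * p)" by auto
    then show "y \<in> {x \<in> ?A. \<forall>i\<in>I. int p dvd x i}"
      using scaled_in_lattice_points_iff[OF p ext, of x "d * p" d] dvd
      by (auto simp: sieved_points_def)
  next
    fix y assume y: "y \<in> {x \<in> ?A. \<forall>i\<in>I. int p dvd x i}"
    define x where "x = (\<lambda>i\<in>I. y i div int p)"
    have yext: "y \<in> I \<rightarrow>\<^sub>E UNIV" using y ext by (auto simp: sieved_points_def)
    have "y i = ?m x i" for i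
      using y yext by (cases "i \<in> I") (auto simp: x_def PiE_iff extensional_def)
    then have yx: "y = ?m x" by blast
    have "x \<in> I \<rightarrow>\<^sub>E UNIV" by (auto simp: x_def)
    then have "x \<in> lattice_points I R (d * p)"
      using y yx scaled_in_lattice_points_iff[OF p, of x d] by (auto simp: sieved_points_def)
    moreover have "\<not> (\<forall>i\<in>I. int q dvd x i)" if "q \<in> S" for q
    proof -
      obtain i where "i \<in> I" "\<not> int q dvd y i" using y \<open>q \<in> S\<close> by (auto simp: sieved_points_def)
      moreover from this have "y i = int p * x i" by (simp add: yx)
      ultimately show ?thesis using dvd[OF that] by auto
    qed
    ultimately have "x \<in> sieved_points I R S (d * p)" by (simp add: sieved_points_def)
    then show "y \<in> ?m ` sieved_points I R S (d * p)" using yx by blast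
  qed
  have "inj_on ?m (sieved_points I R S (d * p))"
  proof (rule inj_onI)
    fix x y assume xy: "x \<in> sieved_points I R S (d * p)" "y \<in> sieved_points I R S (d * p)" "?m x = ?m y"
    have "x i = y i" if "i \<in> I" for i
    proof -
      have "int p * x i = int p * y i" using fun_cong[OF xy(3), of i] that by simp
      then show ?thesis using p by simp
    qed
    moreover have "x \<in> I \<rightarrow>\<^sub>E UNIV" "y \<in> I \<rightarrow>\<^sub>E UNIV"
      using xy(1,2) ext[of _ "d * p"] by (simp_all add: sieved_points_def)
    ultimately show "x = y" by (meson PiE_ext)
  qed
  then have "card (sieved_points I R S (d * p)) = card {x \<in> ?A. \<forall>i\<in>I. int p dvd x i}"
    using card_image multiples by metis
  moreover have "sieved_points I R (insert p S) d = ?A - {x \<in> ?A. \<forall>i\<in>I. int p dvd x i}"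
    by (auto simp: sieved_points_def)
  moreover have "card (?A - D) + card D = card ?A" if "D \<subseteq> ?A" for D
    using finite_sieved_points[OF assms(1), of S] that card_mono[of ?A D]
    by (simp add: card_Diff_subset finite_subset)
  moreover have "{x \<in> ?A. \<forall>i\<in>I. int p dvd x i} \<subseteq> ?A" by blast
  ultimately show ?thesis by presburger
qed

text \<open>A point that survives the primes up to \<open>y\<close> but is not primitive is a multiple of a prime
  exceeding \<open>y\<close>, which the depth of the region bounds.\<close>

lemma card_sieved_points_le_primitive:
  assumes "I \<noteq> {}" "real n \<ge> depth I R"
  shows "card (sieved_points I R {p. prime p \<and> p \<le> y} 1)
           \<le> card (sieved_points I R {p. prime p} 1) + (\<Sum>d\<in>{y<..n}. card (lattice_points I R d))"
proof -
  let ?m = "\<lambda>d x. \<lambda>i\<in>I. int d * x i"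
  let ?U = "\<Union>d\<in>{y<..n}. ?m d ` lattice_points I R d"
  have "sieved_points I R {p. prime p \<and> p \<le> y} 1 \<subseteq> sieved_points I R {p. prime p} 1 \<union> ?U"
  proof (intro subsetI UnCI)
    fix x assume x: "x \<in> sieved_points I R {p. prime p \<and> p \<le> y} 1" and "x \<notin> ?U"
    show "x \<in> sieved_points I R {p. prime p} 1"
    proof (rule ccontr)
      assume "x \<notin> sieved_points I R {p. prime p} 1"
      then obtain p where p: "prime p" "\<forall>i\<in>I. int p dvd x i"
        using x by (auto simp: sieved_points_def)
      have sieved: "\<not> (\<forall>i\<in>I. int q dvd x i)" if "q \<in> {p. prime p \<and> p \<le> y}" for q
        using x that unfolding sieved_points_def by blast
      have "p \<notin> {p. prime p \<and> p \<le> y}" using sieved[of p] p(2) by blast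
      then have "y < p" using p(1) by simp
      define z where "z = (\<lambda>i\<in>I. x i div int p)"
      have xL: "x \<in> lattice_points I R 1" using x by (simp add: sieved_points_def)
      then have "x i = ?m p z i" for i
        using p(2) by (cases "i \<in> I") (auto simp: z_def lattice_points_def PiE_iff extensional_def)
      then have xz: "x = ?m p z" by blast
      moreover have "z \<in> I \<rightarrow>\<^sub>E UNIV" by (auto simp: z_def)
      ultimately have z: "z \<in> lattice_points I R p"
        using scaled_in_lattice_points_iff[of p z 1] prime_ge_1_nat[OF p(1)] xL by simp
      then have "lattice_points I R p \<noteq> {}" by blast
      then have "real p \<le> real n" using le_depth[OF _ assms(1), of p] assms(2) by linarith
      then have "p \<in> {y<..n}" using \<open>y < p\<close> by simp
      then have "x \<in> ?U" using z xz by blast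
      then show False using \<open>x \<notin> ?U\<close> by contradiction
    qed
  qed
  moreover have fin: "finite ?U"
    using finite_lattice_points by (intro finite_UN_I finite_imageI) auto
  ultimately have "card (sieved_points I R {p. prime p \<and> p \<le> y} 1)
      \<le> card (sieved_points I R {p. prime p} 1 \<union> ?U)"
    using finite_sieved_points[of 1] by (intro card_mono) auto
  also have "\<dots> \<le> card (sieved_points I R {p. prime p} 1) + card ?U" by (rule card_Un_le)
  also have "card ?U \<le> (\<Sum>d\<in>{y<..n}. card (?m d ` lattice_points I R d))"
    by (rule card_UN_le) simp
  also have "\<dots> \<le> (\<Sum>d\<in>{y<..n}. card (lattice_points I R d))"
    using finite_lattice_points by (intro sum_mono card_image_le) auto
  finally show ?thesis by simp
qed

end

section \<open>Sparse growing families of regions\<close>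

definition shadow_sum :: "'i set \<Rightarrow> ('i \<Rightarrow> real) set \<Rightarrow> nat \<Rightarrow> real" where
  "shadow_sum I R j = (\<Sum>J | J \<subseteq> I \<and> card J = j. shadow_volume R J)"

text \<open>This is the quantity that the sparsity hypothesis compares with the volume.\<close>

definition boundary_error :: "'i set \<Rightarrow> ('i \<Rightarrow> real) set \<Rightarrow> real" where
  "boundary_error I R =
     depth I R + shadow_sum I R 1 * ln (2 * depth I R) + (\<Sum>j = 2..card I - 1. shadow_sum I R j)"

context down_region
begin

lemma shadow_sum_nonneg: "shadow_sum I R j \<ge> 0"
  by (simp add: shadow_sum_def sum_nonneg shadow_volume_nonneg)

lemma shadow_sum_0:
  assumes "R \<noteq> {}"
  shows "shadow_sum I R 0 = 1"
proof -
  have "{J. J \<subseteq> I \<and> card J = 0} = {{}}"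
    using finite_I by (auto dest: finite_subset)
  then show ?thesis using assms by (simp add: shadow_sum_def shadow_volume_empty)
qed

lemma sum_proper_subsets_by_card:
  fixes c :: real
  assumes "R \<noteq> {}" "card I \<ge> 2"
  shows "(\<Sum>J\<in>Pow I - {I}. shadow_volume R J * c ^ card J)
           = 1 + shadow_sum I R 1 * c + (\<Sum>j = 2..card I - 1. shadow_sum I R j * c ^ j)"
proof -
  have "(\<Sum>J\<in>Pow I - {I}. shadow_volume R J * c ^ card J)
      = (\<Sum>j<card I. \<Sum>J | J \<in> Pow I - {I} \<and> card J = j. shadow_volume R J * c ^ card J)"
    using finite_I by (intro sum.group[symmetric]) (auto intro!: psubset_card_mono)
  also have "\<dots> = (\<Sum>j<card I. shadow_sum I R j * c ^ j)"
    unfolding shadow_sum_def sum_distrib_right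
    by (intro sum.cong) auto
  also have "{..<card I} = insert 0 (insert 1 {2..card I - 1})"
    using assms(2) by auto
  finally show ?thesis using shadow_sum_0[OF assms(1)] by simp
qed

text \<open>The depth absorbs the empty shadow, and \<open>ln (2 * depth I R) \<ge> 1\<close> absorbs the one-dimensional
  ones, because \<open>2 * depth I R\<close> exceeds \<open>e\<close>.\<close>

lemma boundary_volume_le_error:
  assumes "R \<noteq> {}" "card I \<ge> 2" "depth I R \<ge> 3"
  shows "boundary_volume I R \<le> boundary_error I R"
proof -
  have "exp 1 \<le> 2 * depth I R" using exp_le assms(3) by linarith
  then have "1 \<le> ln (2 * depth I R)" using assms(3) by (subst ln_ge_iff) auto
  then have "shadow_sum I R 1 * 1 \<le> shadow_sum I R 1 * ln (2 * depth I R)"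
    by (intro mult_left_mono shadow_sum_nonneg)
  then show ?thesis
    using sum_proper_subsets_by_card[OF assms(1,2), of 1] assms(3)
    by (simp add: boundary_volume_def boundary_error_def)
qed

lemma card_lattice_points_le_main:
  assumes "d \<ge> 1"
  shows "real (card (lattice_points I R d)) \<le> shadow_volume R I / real d ^ card I
           + (\<Sum>J\<in>Pow I - {I}. shadow_volume R J * (1 / real d) ^ card J)"
proof -
  have "(\<Sum>J\<in>Pow I. shadow_volume R J / real d ^ card J)
      = shadow_volume R I / real d ^ card I
        + (\<Sum>J\<in>Pow I - {I}. shadow_volume R J / real d ^ card J)"
    using finite_I by (intro sum.remove) auto
  then show ?thesis using card_lattice_points_le[OF assms] by (simp add: power_divide)
qed

lemma card_lattice_points_le_volume_add_boundary:
  assumes "d \<ge> 1"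
  shows "real (card (lattice_points I R d))
           \<le> shadow_volume R I / real d ^ card I + boundary_volume I R"
proof -
  have "(\<Sum>J\<in>Pow I - {I}. shadow_volume R J * (1 / real d) ^ card J) \<le> boundary_volume I R"
    unfolding boundary_volume_def using assms shadow_volume_nonneg
    by (intro sum_mono mult_left_le power_le_one) auto
  then show ?thesis using card_lattice_points_le_main[OF assms] by linarith
qed

text \<open>Here the logarithm arises: summed over the scales \<open>d\<close> up to the depth, the point
  \<open>(1, \<dots>, 1)\<close> contributes the depth, the one-dimensional shadows contribute a harmonic sum, and
  the shadows of dimension at least two converge.\<close>

lemma sum_card_lattice_points_le:
  assumes "R \<noteq> {}" "card I \<ge> 2" "depth I R \<ge> 3"
  defines "n \<equiv> nat \<lceil>depth I R\<rceil>"
  shows "(\<Sum>d\<in>{y<..n}. real (card (lattice_points I R d)))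
           \<le> shadow_volume R I * (\<Sum>d\<in>{y<..n}. 1 / real d ^ card I)
             + (2 + suminf (\<lambda>d. 1 / real d ^ 2)) * boundary_error I R"
proof -
  let ?D = "depth I R" and ?W = "shadow_sum I R" and ?K = "suminf (\<lambda>d. 1 / real d ^ 2)"
  let ?S = "{y<..n}"
  have n: "1 \<le> n" "real n \<le> 2 * ?D" using assms(3) unfolding n_def by linarith+
  have sub: "?S \<subseteq> {1..n}" by auto
  \<comment> \<open>\<open>harm n - ln n\<close> decreases from its value \<open>1\<close> at \<open>n = 1\<close>.\<close>
  have "decseq (\<lambda>n. harm (Suc n) - ln (Suc n) :: real)" by (rule decseq_harm_diff_ln)
  then have "harm (Suc (n - 1)) - ln (Suc (n - 1)) \<le> harm (Suc 0) - ln (Suc 0 :: real)"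
    using decseqD[of "\<lambda>n. harm (Suc n) - ln (Suc n) :: real" 0 "n - 1"] by simp
  then have "harm n \<le> 1 + ln (real n)" using n(1) by (simp add: harm_def)
  also have "\<dots> \<le> 1 + ln (2 * ?D)" using n by simp
  also have "\<dots> \<le> 2 * ln (2 * ?D)"
  proof -
    have "exp 1 \<le> 2 * ?D" using exp_le assms(3) by linarith
    then have "1 \<le> ln (2 * ?D)" using assms(3) by (subst ln_ge_iff) auto
    then show ?thesis by simp
  qed
  finally have harm: "harm n \<le> 2 * ln (2 * ?D)" .
  have sum1: "(\<Sum>d\<in>?S. 1 / real d) \<le> 2 * ln (2 * ?D)"
  proof -
    have "(\<Sum>d\<in>?S. 1 / real d) \<le> (\<Sum>d\<in>{1..n}. 1 / real d)"
      by (rule sum_mono2[OF _ sub]) auto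
    also have "\<dots> = harm n" by (simp add: harm_def inverse_eq_divide)
    finally show ?thesis using harm by simp
  qed
  have sum2: "(\<Sum>d\<in>?S. (1 / real d) ^ j) \<le> ?K" if "j \<ge> 2" for j
  proof -
    have "(\<Sum>d\<in>?S. (1 / real d) ^ j) \<le> (\<Sum>d\<in>?S. (1 / real d) ^ 2)"
      using that by (intro sum_mono power_decreasing) auto
    also have "\<dots> = (\<Sum>d\<in>?S. 1 / real d ^ 2)" by (simp add: power_divide)
    also have "\<dots> \<le> ?K" by (intro sum_le_suminf summable_inverse_power) auto
    finally show ?thesis .
  qed
  have K: "?K \<ge> 0" by (intro suminf_nonneg summable_inverse_power) auto
  have "(\<Sum>d\<in>?S. real (card (lattice_points I R d)))
      \<le> (\<Sum>d\<in>?S. shadow_volume R I / real d ^ card I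
           + (1 + ?W 1 * (1 / real d) + (\<Sum>j = 2..card I - 1. ?W j * (1 / real d) ^ j)))"
    using card_lattice_points_le_main
    by (intro sum_mono) (simp add: sum_proper_subsets_by_card[OF assms(1,2)])
  also have "\<dots> = shadow_volume R I * (\<Sum>d\<in>?S. 1 / real d ^ card I)
      + (real (card ?S) + ?W 1 * (\<Sum>d\<in>?S. 1 / real d)
        + (\<Sum>j = 2..card I - 1. ?W j * (\<Sum>d\<in>?S. (1 / real d) ^ j)))"
    by (simp add: sum.distrib sum_distrib_left) (rule sum.swap)
  also have "\<dots> \<le> shadow_volume R I * (\<Sum>d\<in>?S. 1 / real d ^ card I)
      + (2 * ?D + ?W 1 * (2 * ln (2 * ?D)) + (\<Sum>j = 2..card I - 1. ?W j * ?K))"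
  proof (intro add_left_mono add_mono)
    show "real (card ?S) \<le> 2 * ?D" using n by simp
    show "?W 1 * (\<Sum>d\<in>?S. 1 / real d) \<le> ?W 1 * (2 * ln (2 * ?D))"
      by (intro mult_left_mono sum1 shadow_sum_nonneg)
    show "(\<Sum>j = 2..card I - 1. ?W j * (\<Sum>d\<in>?S. (1 / real d) ^ j)) \<le> (\<Sum>j = 2..card I - 1. ?W j * ?K)"
      by (intro sum_mono mult_left_mono sum2 shadow_sum_nonneg) auto
  qed
  also have "(2 * ?D + ?W 1 * (2 * ln (2 * ?D)) + (\<Sum>j = 2..card I - 1. ?W j * ?K))
      \<le> (2 + ?K) * boundary_error I R"
  proof -
    have "0 \<le> ?W 1 * ln (2 * ?D)"
      using assms(3) by (intro mult_nonneg_nonneg shadow_sum_nonneg) auto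
    then have "0 \<le> ?K * (?D + ?W 1 * ln (2 * ?D)) + 2 * (\<Sum>j = 2..card I - 1. ?W j)"
      using K assms(3)
      by (intro add_nonneg_nonneg mult_nonneg_nonneg sum_nonneg shadow_sum_nonneg) auto
    then show ?thesis
      unfolding boundary_error_def by (simp add: algebra_simps sum_distrib_left)
  qed
  finally show ?thesis by simp
qed

end

locale sparse_family =
  fixes I :: "'i set" and R :: "real \<Rightarrow> ('i \<Rightarrow> real) set" and B :: "real \<Rightarrow> real"
  assumes region: "\<And>X. down_region I (R X) (B X)"
    and card_I: "card I \<ge> 2"
    and volume_at_top: "filterlim (\<lambda>X. shadow_volume (R X) I) at_top at_top"
    and depth_at_top: "filterlim (\<lambda>X. depth I (R X)) at_top at_top"
    and sparse: "(\<lambda>X. boundary_error I (R X)) \<in> o[at_top](\<lambda>X. shadow_volume (R X) I)"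
begin

abbreviation V :: "real \<Rightarrow> real" where "V X \<equiv> shadow_volume (R X) I"

lemma eventually_large: "eventually (\<lambda>X. V X > 0 \<and> R X \<noteq> {} \<and> depth I (R X) \<ge> 3) at_top"
proof -
  have "eventually (\<lambda>X. V X > 0) at_top"
    using volume_at_top by (simp add: filterlim_at_top_dense)
  moreover have "eventually (\<lambda>X. depth I (R X) \<ge> 3) at_top"
    using depth_at_top by (simp add: filterlim_at_top)
  ultimately show ?thesis
    by eventually_elim (auto simp: shadow_volume_def)
qed

lemma error_tendsto: "((\<lambda>X. boundary_error I (R X) / V X) \<longlongrightarrow> 0) at_top"
  using sparse by (rule smalloD_tendsto)

text \<open>For a fixed scale, the upper bound by cubes and the lower bound by division with remainder
  differ from \<open>V / d\<^sup>r\<close> by at most a constant multiple of the boundary volume, which is negligible.\<close>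

lemma lattice_points_tendsto:
  assumes "d \<ge> 1"
  shows "((\<lambda>X. real (card (lattice_points I (R X) d)) / V X) \<longlongrightarrow> 1 / real d ^ card I) at_top"
proof (rule tendsto_sandwich)
  let ?E = "\<lambda>X. boundary_error I (R X) / V X" and ?r = "card I"
  let ?c = "real ?r * real d"
  have d: "real d ^ ?r > 0" using assms by simp
  have "eventually (\<lambda>X. (1 - ?c * ?E X) / real d ^ ?r \<le> real (card (lattice_points I (R X) d)) / V X
      \<and> real (card (lattice_points I (R X) d)) / V X \<le> 1 / real d ^ ?r + ?E X) at_top"
    using eventually_large
  proof eventually_elim
    case (elim X)
    interpret down_region I "R X" "B X" by (rule region)
    have E: "boundary_volume I (R X) \<le> boundary_error I (R X)"
      using boundary_volume_le_error elim card_I by blast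
    then have "?c * boundary_volume I (R X) \<le> ?c * boundary_error I (R X)"
      by (intro mult_left_mono) auto
    then have "V X - ?c * boundary_error I (R X) \<le> real d ^ ?r * real (card (lattice_points I (R X) d))"
      using card_lattice_points_ge[OF assms] by linarith
    then have "(V X - ?c * boundary_error I (R X)) / V X
        \<le> real d ^ ?r * real (card (lattice_points I (R X) d)) / V X"
      using elim by (intro divide_right_mono) auto
    then have "1 - ?c * ?E X \<le> real d ^ ?r * (real (card (lattice_points I (R X) d)) / V X)"
      using elim by (simp add: diff_divide_distrib)
    then have 1: "(1 - ?c * ?E X) / real d ^ ?r \<le> real (card (lattice_points I (R X) d)) / V X"
      using d by (simp add: pos_divide_le_eq mult.commute)
    have "real (card (lattice_points I (R X) d)) / V X \<le> (V X / real d ^ ?r + boundary_error I (R X)) / V X"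
      using card_lattice_points_le_volume_add_boundary[OF assms] E elim
      by (intro divide_right_mono) auto
    also have "\<dots> = 1 / real d ^ ?r + ?E X" using elim by (simp add: add_divide_distrib)
    finally show ?case using 1 by blast
  qed
  then show "eventually (\<lambda>X. (1 - ?c * ?E X) / real d ^ ?r \<le> real (card (lattice_points I (R X) d)) / V X) at_top"
    and "eventually (\<lambda>X. real (card (lattice_points I (R X) d)) / V X \<le> 1 / real d ^ ?r + ?E X) at_top"
    by (simp_all add: eventually_conj_iff)
  show "((\<lambda>X. (1 - ?c * ?E X) / real d ^ ?r) \<longlongrightarrow> 1 / real d ^ ?r) at_top"
  proof -
    have "((\<lambda>X. (1 - ?c * ?E X) / real d ^ ?r) \<longlongrightarrow> (1 - ?c * 0) / real d ^ ?r) at_top"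
      using d by (intro tendsto_intros error_tendsto) auto
    then show ?thesis by simp
  qed
  show "((\<lambda>X. 1 / real d ^ ?r + ?E X) \<longlongrightarrow> 1 / real d ^ ?r) at_top"
    using tendsto_add[OF tendsto_const error_tendsto, of "1 / real d ^ ?r"] by simp
qed

text \<open>Each new prime \<open>p\<close> subtracts the limit at scale \<open>d p\<close>, that is, \<open>p\<^sup>-\<^sup>r\<close> times the limit at scale
  \<open>d\<close>. The scale has to be arbitrary for the induction to go through.\<close>

lemma sieved_points_tendsto:
  assumes "finite S" "\<And>p. p \<in> S \<Longrightarrow> prime p" "d \<ge> 1"
  shows "((\<lambda>X. real (card (sieved_points I (R X) S d)) / V X)
           \<longlongrightarrow> 1 / real d ^ card I * (\<Prod>p\<in>S. 1 - 1 / real p ^ card I)) at_top"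
  using assms
proof (induction S arbitrary: d rule: finite_induct)
  case empty
  then show ?case using lattice_points_tendsto[of d] by (simp add: sieved_points_def)
next
  case (insert p S)
  let ?P = "\<Prod>p\<in>S. 1 - 1 / real p ^ card I"
  have p: "prime p" "p \<ge> 1" using insert.prems prime_ge_1_nat by auto
  have "card (sieved_points I (R X) (insert p S) d) + card (sieved_points I (R X) S (d * p))
      = card (sieved_points I (R X) S d)" for X
    using down_region.card_sieved_points_insert[OF region] insert p by blast
  then have "real (card (sieved_points I (R X) (insert p S) d))
      = real (card (sieved_points I (R X) S d)) - real (card (sieved_points I (R X) S (d * p)))" for X
    by (metis add_diff_cancel_right' of_nat_add)
  moreover have "((\<lambda>X. real (card (sieved_points I (R X) S d)) / V X
        - real (card (sieved_points I (R X) S (d * p))) / V X)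
      \<longlongrightarrow> 1 / real d ^ card I * ?P - 1 / real (d * p) ^ card I * ?P) at_top"
    proof (intro tendsto_diff insert.IH)
    show "d * p \<ge> 1" using insert.prems(2) p(2) by simp
  qed (use insert.prems in auto)
  moreover have "1 / real d ^ card I * ?P - 1 / real (d * p) ^ card I * ?P
      = 1 / real d ^ card I * (\<Prod>p\<in>insert p S. 1 - 1 / real p ^ card I)"
    using insert.hyps by (simp add: power_mult_distrib algebra_simps)
  ultimately show ?case by (simp add: diff_divide_distrib)
qed

text \<open>Sieving by the primes up to \<open>y\<close> leaves too many points, but the excess is at most the number
  of points divisible by some \<open>d > y\<close>. Relative to the volume this is, up to a negligible error,
  at most a tail of the zeta series, so letting \<open>y\<close> grow gives the density of the primitive points.\<close>

lemma primitive_points_tendsto: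
  "((\<lambda>X. real (card (sieved_points I (R X) {p. prime p} 1)) / V X)
     \<longlongrightarrow> 1 / real_zeta (real (card I))) at_top"
proof (rule tendstoI)
  fix e :: real assume e: "e > 0"
  let ?z = "1 / real_zeta (real (card I))" and ?C = "2 + suminf (\<lambda>d. 1 / real d ^ 2)"
  let ?P = "\<lambda>y. \<Prod>p | prime p \<and> p \<le> y. 1 - 1 / real p ^ card I"
  let ?E = "\<lambda>X. boundary_error I (R X) / V X"
  \<comment> \<open>Four errors are each brought below \<open>e / 4\<close>: the zeta tail and the distance of the finite Euler
    product from its limit by the choice of \<open>y\<close>, the other two by letting \<open>X\<close> grow.\<close>
  obtain y1 where y1: "\<And>m n. m \<ge> y1 \<Longrightarrow> norm (\<Sum>d\<in>{m..<n}. 1 / real d ^ card I) < e / 4"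
    using summable_inverse_power[OF card_I] e unfolding summable_Cauchy
    by (metis divide_pos_pos zero_less_numeral)
  obtain y2 where y2: "\<And>y. y \<ge> y2 \<Longrightarrow> dist (?P y) ?z < e / 4"
    using metric_LIMSEQ_D[OF euler_product_tendsto(1)[OF card_I], of "e / 4"] e by auto
  define y where "y = max y1 y2"
  have tail: "(\<Sum>d\<in>{y<..n}. 1 / real d ^ card I) < e / 4" for n
  proof -
    have "y1 \<le> Suc y" by (simp add: y_def)
    then have "norm (\<Sum>d\<in>{Suc y..<Suc n}. 1 / real d ^ card I) < e / 4" by (rule y1)
    moreover have "{y<..n} = {Suc y..<Suc n}" by auto
    ultimately show ?thesis by (metis abs_less_iff real_norm_def)
  qed
  have "((\<lambda>X. real (card (sieved_points I (R X) {p. prime p \<and> p \<le> y} 1)) / V X) \<longlongrightarrow> ?P y) at_top"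
  proof -
    have "finite {p. prime p \<and> p \<le> y}" by (rule finite_subset[of _ "{..y}"]) auto
    then have "((\<lambda>X. real (card (sieved_points I (R X) {p. prime p \<and> p \<le> y} 1)) / V X)
        \<longlongrightarrow> 1 / real 1 ^ card I * ?P y) at_top"
      by (rule sieved_points_tendsto) auto
    then show ?thesis by simp
  qed
  then have "eventually (\<lambda>X. dist (real (card (sieved_points I (R X) {p. prime p \<and> p \<le> y} 1)) / V X) (?P y) < e / 4) at_top"
    using e by (intro tendstoD) auto
  moreover have "((\<lambda>X. ?C * ?E X) \<longlongrightarrow> ?C * 0) at_top"
    by (intro tendsto_mult_left error_tendsto)
  then have "eventually (\<lambda>X. dist (?C * ?E X) (?C * 0) < e / 4) at_top"
    using e by (intro tendstoD) auto
  ultimately show "eventually (\<lambda>X. dist (real (card (sieved_points I (R X) {p. prime p} 1)) / V X) ?z < e) at_top"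
    using eventually_large
  proof eventually_elim
    case (elim X)
    interpret down_region I "R X" "B X" by (rule region)
    define n where "n = nat \<lceil>depth I (R X)\<rceil>"
    define s where "s = real (card (sieved_points I (R X) {p. prime p \<and> p \<le> y} 1))"
    define t where "t = real (card (sieved_points I (R X) {p. prime p} 1))"
    have V: "V X > 0" using elim by blast
    have "sieved_points I (R X) {p. prime p} 1 \<subseteq> sieved_points I (R X) {p. prime p \<and> p \<le> y} 1"
      by (auto simp: sieved_points_def)
    then have "t \<le> s"
      unfolding s_def t_def by (intro of_nat_mono card_mono finite_sieved_points) auto
    then have upper: "t / V X \<le> s / V X" using V by (simp add: divide_right_mono)
    have "I \<noteq> {}" using card_I by auto
    then have "card (sieved_points I (R X) {p. prime p \<and> p \<le> y} 1)
        \<le> card (sieved_points I (R X) {p. prime p} 1) + (\<Sum>d\<in>{y<..n}. card (lattice_points I (R X) d))"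
      by (rule card_sieved_points_le_primitive) (simp add: n_def real_nat_ceiling_ge)
    then have "s \<le> t + (\<Sum>d\<in>{y<..n}. real (card (lattice_points I (R X) d)))"
      unfolding s_def t_def by (simp flip: of_nat_sum of_nat_add)
    also have "(\<Sum>d\<in>{y<..n}. real (card (lattice_points I (R X) d)))
        \<le> V X * (\<Sum>d\<in>{y<..n}. 1 / real d ^ card I) + ?C * boundary_error I (R X)"
      unfolding n_def using elim card_I by (intro sum_card_lattice_points_le) auto
    also have "V X * (\<Sum>d\<in>{y<..n}. 1 / real d ^ card I) \<le> V X * (e / 4)"
      using tail V by (intro mult_left_mono less_imp_le) auto
    finally have "s / V X \<le> (t + (V X * (e / 4) + ?C * boundary_error I (R X))) / V X"
      using V by (intro divide_right_mono) auto
    also have "\<dots> = t / V X + e / 4 + ?C * ?E X" using V by (simp add: add_divide_distrib)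
    finally have lower: "s / V X \<le> t / V X + e / 4 + ?C * ?E X" .
    have "\<bar>s / V X - ?P y\<bar> < e / 4" "\<bar>?C * ?E X\<bar> < e / 4" "\<bar>?P y - ?z\<bar> < e / 4"
      using elim y2[of y] by (simp_all add: dist_real_def s_def y_def)
    then have "\<bar>t / V X - ?z\<bar> < e" using upper lower by linarith
    then show ?case by (simp add: dist_real_def t_def)
  qed
qed

end

section \<open>Visibility and divisibility\<close>

lemma integral_point_graph_map_iff:
  assumes "\<forall>j\<in>{1..s}. mpoly_vars (F j) \<subseteq> {1..r}"
  shows "integral_point (r + s) (graph_map r s F y) \<longleftrightarrow> (\<forall>i\<in>{1..r}. y i \<in> \<int>)"
proof
  assume int: "integral_point (r + s) (graph_map r s F y)"
  show "\<forall>i\<in>{1..r}. y i \<in> \<int>"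
  proof
    fix i assume "i \<in> {1..r}"
    then have "i \<in> {1..r + s}" "graph_map r s F y i = y i" by (simp_all add: graph_map_def)
    then show "y i \<in> \<int>" using int by (metis integral_point_def)
  qed
next
  assume y: "\<forall>i\<in>{1..r}. y i \<in> \<int>"
  have "mpoly_eval (F j) y \<in> \<int>" if "j \<in> {1..s}" for j
    using bspec[OF assms that] y by (intro mpoly_eval_Ints) auto
  moreover have "i - r \<in> {1..s}" if "i \<in> {1..r + s}" "\<not> i \<le> r" for i using that by auto
  ultimately show "integral_point (r + s) (graph_map r s F y)"
    using y by (simp add: integral_point_def graph_map_def)
qed

text \<open>The parameter \<open>a\<close> of the branch through the point above \<open>x\<close>.\<close>

definition slopes :: "nat \<Rightarrow> (nat \<Rightarrow> int) \<Rightarrow> nat \<Rightarrow> real" where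
  "slopes r x = (\<lambda>i\<in>{2..r}. of_int (x i) / of_int (x 1))"

lemma slopes_in:
  assumes "\<forall>i\<in>{1..r}. x i \<ge> 1" "r \<ge> 1"
  shows "slopes r x \<in> {2..r} \<rightarrow>\<^sub>E {q \<in> \<rat>. 0 < q}"
proof (rule PiE_I)
  fix i assume i: "i \<in> {2..r}"
  then have "x i \<ge> 1" "x 1 \<ge> 1" using assms by auto
  then show "slopes r x i \<in> {q \<in> \<rat>. 0 < q}" using i by (auto simp: slopes_def)
qed (auto simp: slopes_def)

lemma radial_branch_slopes:
  assumes "\<forall>i\<in>{1..r}. x i \<ge> 1" "r \<ge> 1"
    and vars: "\<forall>j\<in>{1..s}. mpoly_vars (F j) \<subseteq> {1..r}"
  shows "radial_branch r s F (slopes r x) (l * of_int (x 1)) = graph_map r s F (\<lambda>i. l * of_int (x i))"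
proof -
  have "x 1 \<noteq> 0" using assms(1,2) by force
  then show ?thesis
    unfolding radial_branch_def by (intro graph_map_cong[OF vars[rule_format]]) (auto simp: slopes_def)
qed

text \<open>A branch point determines its branch and its parameter, so both visibility notions reduce to
  a condition on the scaled points \<open>l x\<close> with \<open>0 < l < 1\<close>.\<close>

lemma branch_witness_iff:
  assumes x: "\<forall>i\<in>{1..r}. x i \<ge> 1" "r \<ge> 1"
    and vars: "\<forall>j\<in>{1..s}. mpoly_vars (F j) \<subseteq> {1..r}"
  shows "(\<exists>\<phi>\<in>radial_graph_family r s F. \<exists>t>0.
            graph_map r s F (\<lambda>i. of_int (x i)) = \<phi> t \<and> integral_point (r + s) (\<phi> t) \<and> Q \<phi> t)
          \<longleftrightarrow> Q (radial_branch r s F (slopes r x)) (of_int (x 1))" (is "?L \<longleftrightarrow> ?R")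
proof
  have eq: "graph_map r s F (\<lambda>i. of_int (x i)) = radial_branch r s F (slopes r x) (of_int (x 1))"
    using radial_branch_slopes[OF assms, of 1] by simp
  have x1: "real_of_int (x 1) > 0" using x by force
  {
    assume ?L
    then obtain a t where a: "a \<in> {2..r} \<rightarrow>\<^sub>E {q \<in> \<rat>. 0 < q}" and t: "0 < t"
      and P: "graph_map r s F (\<lambda>i. of_int (x i)) = radial_branch r s F a t"
      and Q: "Q (radial_branch r s F a) t"
      by (auto simp: radial_graph_family_def)
    have "slopes r x = a" "of_int (x 1) = t"
      using radial_branch_inject[OF x(2) slopes_in[OF x] a x1] P eq by simp_all
    then show ?R using Q by simp
  next
    assume ?R
    moreover have "integral_point (r + s) (radial_branch r s F (slopes r x) (of_int (x 1)))"
      unfolding eq[symmetric] by (simp add: integral_point_graph_map_iff[OF vars])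
    ultimately show ?L
      using eq x1 slopes_in[OF x] unfolding radial_graph_family_def by blast
  }
qed

lemma scaling_parameter_iff:
  assumes x: "\<forall>i\<in>{1..r}. x i \<ge> 1" "r \<ge> 1"
    and vars: "\<forall>j\<in>{1..s}. mpoly_vars (F j) \<subseteq> {1..r}"
  shows "(\<exists>u. 0 < u \<and> u < of_int (x 1) \<and> integral_point (r + s) (radial_branch r s F (slopes r x) u)
            \<and> Q (radial_branch r s F (slopes r x) u))
          \<longleftrightarrow> (\<exists>l. 0 < l \<and> l < 1 \<and> (\<forall>i\<in>{1..r}. l * of_int (x i) \<in> \<int>)
            \<and> Q (graph_map r s F (\<lambda>i. l * of_int (x i))))"
proof -
  have x1: "real_of_int (x 1) > 0" using x by force
  show ?thesis (is "?L \<longleftrightarrow> ?R")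
  proof
    assume ?L
    then obtain u where u: "0 < u" "u < of_int (x 1)"
      "integral_point (r + s) (radial_branch r s F (slopes r x) u)" "Q (radial_branch r s F (slopes r x) u)"
      by blast
    define l where "l = u / of_int (x 1)"
    have ul: "u = l * of_int (x 1)" using x1 by (simp add: l_def)
    show ?R
      using u x1 unfolding ul radial_branch_slopes[OF assms] integral_point_graph_map_iff[OF vars]
      by (intro exI[of _ l]) (auto simp: zero_less_mult_iff)
  next
    assume ?R
    then obtain l where l: "0 < l" "l < 1" "\<forall>i\<in>{1..r}. l * of_int (x i) \<in> \<int>"
      "Q (graph_map r s F (\<lambda>i. l * of_int (x i)))" by blast
    then show ?L
      using x1 integral_point_graph_map_iff[OF vars, where y = "\<lambda>i. l * of_int (x i)"]
      by (intro exI[of _ "l * of_int (x 1)"])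
         (simp add: radial_branch_slopes[OF assms] del: One_nat_def)
  qed
qed

lemma globally_visible_iff_scaling:
  assumes "\<forall>i\<in>{1..r}. x i \<ge> 1" "r \<ge> 1"
    and "\<forall>j\<in>{1..s}. mpoly_vars (F j) \<subseteq> {1..r}"
  shows "globally_visible (r + s) (radial_graph_family r s F) (graph_map r s F (\<lambda>i. of_int (x i)))
           \<longleftrightarrow> \<not> (\<exists>l::real. 0 < l \<and> l < 1 \<and> (\<forall>i\<in>{1..r}. l * of_int (x i) \<in> \<int>))"
  unfolding globally_visible_def branch_witness_iff[OF assms]
  using scaling_parameter_iff[OF assms, where Q = "\<lambda>_. True"] by simp

lemma padically_visible_iff_scaling:
  assumes "\<forall>i\<in>{1..r}. x i \<ge> 1" "r \<ge> 1"
    and "\<forall>j\<in>{1..s}. mpoly_vars (F j) \<subseteq> {1..r}"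
  shows "padically_visible (r + s) (radial_graph_family r s F) p (graph_map r s F (\<lambda>i. of_int (x i)))
           \<longleftrightarrow> (\<forall>l::real. 0 < l \<and> l < 1 \<and> (\<forall>i\<in>{1..r}. l * of_int (x i) \<in> \<int>) \<longrightarrow>
                 point_val (r + s) p (graph_map r s F (\<lambda>i. of_int (x i)))
                   \<le> point_val (r + s) p (graph_map r s F (\<lambda>i. l * of_int (x i))))"
proof -
  have eq: "radial_branch r s F (slopes r x) (of_int (x 1)) = graph_map r s F (\<lambda>i. of_int (x i))"
    using radial_branch_slopes[OF assms, of 1] by simp
  show ?thesis
    unfolding padically_visible_def branch_witness_iff[OF assms] eq
    using scaling_parameter_iff[OF assms, where Q = "\<lambda>P. \<not> point_val (r + s) p (graph_map r s F (\<lambda>i. of_int (x i))) \<le> point_val (r + s) p P"]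
    by blast
qed

text \<open>If \<open>l = a / b\<close> in lowest terms scales an integral point to an integral point, then \<open>b\<close>
  divides all coordinates.\<close>

lemma ex_integral_scaling_iff:
  fixes x :: "'i \<Rightarrow> int"
  assumes "\<forall>i\<in>I. x i \<ge> 1" "I \<noteq> {}"
  shows "(\<exists>l::real. 0 < l \<and> l < 1 \<and> (\<forall>i\<in>I. l * of_int (x i) \<in> \<int>)) \<longleftrightarrow> Gcd (x ` I) \<noteq> 1"
proof
  assume "\<exists>l::real. 0 < l \<and> l < 1 \<and> (\<forall>i\<in>I. l * of_int (x i) \<in> \<int>)"
  then obtain l :: real where l: "0 < l" "l < 1" and int: "\<And>i. i \<in> I \<Longrightarrow> l * of_int (x i) \<in> \<int>"
    by blast
  obtain i where i: "i \<in> I" using assms(2) by blast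
  then obtain k where "l * of_int (x i) = of_int k" using int Ints_cases by metis
  then have "l = of_int k / of_int (x i)" using assms(1) i by (force simp: field_simps)
  then have "l \<in> \<rat>" by simp
  then obtain a b :: int where ab: "b > 0" "coprime a b" "l = of_int a / of_int b"
    by (metis Rats_cases')
  have "b dvd x j" if j: "j \<in> I" for j
  proof -
    obtain k where "l * of_int (x j) = of_int k" using int[OF j] Ints_cases by metis
    then have "real_of_int (a * x j) = of_int (k * b)" using ab by (simp add: field_simps)
    then have "b dvd a * x j" by (simp only: of_int_eq_iff) simp
    then show ?thesis using ab(2) by (simp add: coprime_dvd_mult_right_iff coprime_commute)
  qed
  then have dvd: "b dvd Gcd (x ` I)" by (auto intro: Gcd_greatest)
  show "Gcd (x ` I) \<noteq> 1"
  proof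
    assume "Gcd (x ` I) = 1"
    then have "b = 1" using dvd ab(1) by auto
    then show False using l ab(3) by auto
  qed
next
  assume ne: "Gcd (x ` I) \<noteq> 1"
  define g where "g = Gcd (x ` I)"
  obtain i where i: "i \<in> I" using assms(2) by blast
  then have "x i \<noteq> 0" using assms(1) by force
  then have "g \<noteq> 0" using i by (auto simp: g_def Gcd_0_iff)
  moreover have "g \<ge> 0" by (simp add: g_def)
  ultimately have g: "g > 1" using ne g_def by linarith
  have "1 / real_of_int g * of_int (x j) \<in> \<int>" if "j \<in> I" for j
  proof -
    have "g dvd x j" using that by (simp add: g_def)
    then obtain k where "x j = g * k" ..
    then have "1 / real_of_int g * of_int (x j) = of_int k" using g by (simp add: field_simps)
    then show ?thesis by simp
  qed
  then show "\<exists>l::real. 0 < l \<and> l < 1 \<and> (\<forall>i\<in>I. l * of_int (x i) \<in> \<int>)"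
    using g by (intro exI[of _ "1 / real_of_int g"]) auto
qed

lemma Gcd_eq_1_iff_no_prime_dvd:
  fixes x :: "'i \<Rightarrow> int"
  assumes "\<forall>i\<in>I. x i \<ge> 1" "I \<noteq> {}"
  shows "Gcd (x ` I) = 1 \<longleftrightarrow> (\<forall>p::nat. prime p \<longrightarrow> \<not> (\<forall>i\<in>I. int p dvd x i))"
proof
  assume 1: "Gcd (x ` I) = 1"
  show "\<forall>p::nat. prime p \<longrightarrow> \<not> (\<forall>i\<in>I. int p dvd x i)"
  proof (intro allI impI notI)
    fix p :: nat assume "prime p" "\<forall>i\<in>I. int p dvd x i"
    then have "int p dvd 1" using 1 Gcd_greatest[of "x ` I" "int p"] by auto
    then show False using \<open>prime p\<close> by auto
  qed
next
  assume none: "\<forall>p::nat. prime p \<longrightarrow> \<not> (\<forall>i\<in>I. int p dvd x i)"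
  show "Gcd (x ` I) = 1"
  proof (rule ccontr)
    assume ne: "Gcd (x ` I) \<noteq> 1"
    moreover have "Gcd (x ` I) \<ge> 0" by simp
    ultimately have "\<not> is_unit (Gcd (x ` I))" by auto
    moreover have "Gcd (x ` I) \<noteq> 0"
    proof -
      obtain i where "i \<in> I" using assms(2) by blast
      then show ?thesis using assms(1) by (force simp: Gcd_0_iff)
    qed
    ultimately obtain q where q: "prime q" "q dvd Gcd (x ` I)"
      using prime_divisor_exists by metis
    then have "prime (nat q)" "int (nat q) = q" by (auto simp: prime_ge_0_int)
    moreover have "\<forall>i\<in>I. q dvd x i" using q(2) by (meson Gcd_dvd dvd_trans imageI)
    ultimately show False using none by metis
  qed
qed

lemma mpoly_eval_scale:
  assumes "homogeneous d f"
  shows "mpoly_eval f (\<lambda>i. c * y i) = c ^ d * mpoly_eval f y"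
proof -
  have "(\<Prod>i\<in>Poly_Mapping.keys m. (c * y i) ^ Poly_Mapping.lookup m i)
      = c ^ d * (\<Prod>i\<in>Poly_Mapping.keys m. y i ^ Poly_Mapping.lookup m i)"
    if "m \<in> Poly_Mapping.keys f" for m
    using assms that
    by (auto simp: power_mult_distrib prod.distrib power_sum[symmetric] homogeneous_def monom_degree_def)
  then show ?thesis
    unfolding mpoly_eval_def sum_distrib_left by (intro sum.cong) auto
qed

lemma int_val_scale:
  assumes "prime p" "e \<ge> 1"
  shows "int_val p k + 1 \<le> int_val p (int p ^ e * k)"
proof (cases "k = 0")
  case False
  have p: "prime (int p)" "int p \<noteq> 0" using assms(1) by auto
  then have "multiplicity (int p) (int p ^ e * k) = e + multiplicity (int p) k"
    using False by (simp add: prime_elem_multiplicity_mult_distrib multiplicity_same_power)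
  then show ?thesis using False p assms(2) by (simp add: int_val_def one_enat_def)
qed (simp add: int_val_def)

text \<open>Every coordinate of the graph map is homogeneous of positive degree, so dividing the base
  point by \<open>p\<close> lowers all its finite valuations, and the finite minimum drops strictly.\<close>

lemma point_val_less_scale:
  assumes p: "prime p" and y: "\<forall>i\<in>{1..r}. y i \<ge> 1" "r \<ge> 1"
    and vars: "\<forall>j\<in>{1..s}. mpoly_vars (F j) \<subseteq> {1..r}"
    and deg: "\<forall>j\<in>{1..s}. \<delta> j \<ge> 1"
    and hom: "\<forall>j\<in>{1..s}. homogeneous (\<delta> j) (F j)"
  shows "point_val (r + s) p (graph_map r s F (\<lambda>i. of_int (y i)))
           < point_val (r + s) p (graph_map r s F (\<lambda>i. of_int (int p * y i)))"
proof -
  let ?y = "graph_map r s F (\<lambda>i. of_int (y i))" and ?x = "graph_map r s F (\<lambda>i. of_int (int p * y i))"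
  have coord: "int_val p \<lfloor>?y i\<rfloor> + 1 \<le> int_val p \<lfloor>?x i\<rfloor>" if i: "i \<in> {1..r + s}" for i
  proof -
    define e where "e = (if i \<le> r then 1 else \<delta> (i - r))"
    have j: "i - r \<in> {1..s}" if "\<not> i \<le> r" using i that by auto
    have e: "e \<ge> 1" using bspec[OF deg j] by (auto simp: e_def)
    have "integral_point (r + s) ?y" by (simp add: integral_point_graph_map_iff[OF vars])
    then obtain k where k: "?y i = of_int k" using i Ints_cases unfolding integral_point_def by metis
    have "?x i = real p ^ e * ?y i"
      using i mpoly_eval_scale[OF bspec[OF hom j], of "real p" "\<lambda>i. of_int (y i)"]
      by (simp add: graph_map_def e_def)
    then have "?x i = of_int (int p ^ e * k)" using k by simp
    then show ?thesis using int_val_scale[OF p e, of k] k by (simp only: floor_of_int)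
  qed
  have "point_val (r + s) p ?x \<in> (\<lambda>i. int_val p \<lfloor>?x i\<rfloor>) ` {1..r + s}"
    unfolding point_val_def using y(2) by (intro Min_in) auto
  then obtain i where i: "i \<in> {1..r + s}" "point_val (r + s) p ?x = int_val p \<lfloor>?x i\<rfloor>" by blast
  have le: "point_val (r + s) p ?y \<le> int_val p \<lfloor>?y j\<rfloor>" if "j \<in> {1..r + s}" for j
    unfolding point_val_def using that by (intro Min_le) auto
  have "y 1 \<noteq> 0" "?y 1 = of_int (y 1)" using y by (force, simp add: graph_map_def)
  then have "point_val (r + s) p ?y \<noteq> \<infinity>"
    using le[of 1] y(2) by (auto simp: int_val_def dest: enat_ile)
  then have "point_val (r + s) p ?y < point_val (r + s) p ?y + 1"
    by (cases "point_val (r + s) p ?y") (auto simp: one_enat_def)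
  also have "\<dots> \<le> int_val p \<lfloor>?y i\<rfloor> + 1" using le[OF i(1)] by (rule add_right_mono)
  also have "\<dots> \<le> point_val (r + s) p ?x" using coord[OF i(1)] i(2) by simp
  finally show ?thesis .
qed

lemma globally_visible_iff_Gcd:
  assumes "\<forall>i\<in>{1..r}. x i \<ge> 1" "r \<ge> 1"
    and "\<forall>j\<in>{1..s}. mpoly_vars (F j) \<subseteq> {1..r}"
  shows "globally_visible (r + s) (radial_graph_family r s F) (graph_map r s F (\<lambda>i. of_int (x i)))
           \<longleftrightarrow> Gcd (x ` {1..r}) = 1"
proof -
  have "{1..r} \<noteq> {}" using assms(2) by auto
  then show ?thesis
    unfolding globally_visible_iff_scaling[OF assms] using ex_integral_scaling_iff[OF assms(1)] by blast
qed

text \<open>If \<open>p\<close> divides all coordinates, the earlier integral point above \<open>x / p\<close> has smaller valuation.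
  Otherwise the valuation is already \<open>0\<close>, and no earlier point can fall below it.\<close>

lemma padically_visible_iff_not_dvd:
  assumes p: "prime p" and x: "\<forall>i\<in>{1..r}. x i \<ge> 1" "r \<ge> 1"
    and vars: "\<forall>j\<in>{1..s}. mpoly_vars (F j) \<subseteq> {1..r}"
    and deg: "\<forall>j\<in>{1..s}. \<delta> j \<ge> 1"
    and hom: "\<forall>j\<in>{1..s}. homogeneous (\<delta> j) (F j)"
  shows "padically_visible (r + s) (radial_graph_family r s F) p (graph_map r s F (\<lambda>i. of_int (x i)))
           \<longleftrightarrow> \<not> (\<forall>i\<in>{1..r}. int p dvd x i)"
proof (cases "\<forall>i\<in>{1..r}. int p dvd x i")
  case True
  define y where "y i = x i div int p" for i
  have p0: "real p > 0" "real p > 1" using prime_gt_0_nat[OF p] prime_gt_1_nat[OF p] by auto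
  have xy: "x i = int p * y i" if "i \<in> {1..r}" for i using True that by (simp add: y_def)
  have y: "\<forall>i\<in>{1..r}. y i \<ge> 1"
  proof
    fix i assume i: "i \<in> {1..r}"
    then have "0 < int p * y i" using xy[OF i] x(1) by force
    then show "y i \<ge> 1" using p0 by (simp add: zero_less_mult_iff)
  qed
  have scaled: "1 / real p * of_int (x i) = of_int (y i)" if "i \<in> {1..r}" for i
    using xy[OF that] p0 by simp
  have "graph_map r s F (\<lambda>i. of_int (x i)) = graph_map r s F (\<lambda>i. of_int (int p * y i))"
    by (rule graph_map_cong[OF vars[rule_format]]) (simp_all add: xy)
  moreover have "graph_map r s F (\<lambda>i. 1 / real p * of_int (x i)) = graph_map r s F (\<lambda>i. of_int (y i))"
    by (rule graph_map_cong[OF vars[rule_format]]) (use scaled in auto)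
  moreover have "0 < 1 / real p \<and> 1 / real p < 1 \<and> (\<forall>i\<in>{1..r}. 1 / real p * of_int (x i) \<in> \<int>)"
    using p0 scaled by simp
  ultimately show ?thesis
    using padically_visible_iff_scaling[OF x vars, where p = p]
      point_val_less_scale[OF p y x(2) vars deg hom] True
    by (metis not_le)
next
  case False
  then obtain i where i: "i \<in> {1..r}" "\<not> int p dvd x i" by blast
  let ?P = "graph_map r s F (\<lambda>i. of_int (x i))"
  have "point_val (r + s) p ?P \<le> int_val p \<lfloor>?P i\<rfloor>"
    unfolding point_val_def using i(1) by (intro Min_le) auto
  also have "?P i = of_int (x i)" using i(1) by (simp add: graph_map_def)
  also have "int_val p \<lfloor>real_of_int (x i)\<rfloor> = 0"
    using i(2) by (auto simp: int_val_def not_dvd_imp_multiplicity_0 zero_enat_def)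
  finally have "point_val (r + s) p ?P = 0" by simp
  then show ?thesis
    using padically_visible_iff_scaling[OF x vars, where p = p] False by simp
qed

section \<open>The counting region\<close>

lemma height_le_iff: "n \<ge> 1 \<Longrightarrow> height n P \<le> X \<longleftrightarrow> (\<forall>i\<in>{1..n}. \<bar>P i\<bar> \<le> X)"
  unfolding height_def by (subst Max_le_iff) auto

lemma mpoly_eval_nonneg:
  assumes "nonneg_coeffs f" "mpoly_vars f \<subseteq> A" "\<And>i. i \<in> A \<Longrightarrow> 0 \<le> x i"
  shows "0 \<le> mpoly_eval f x"
  unfolding mpoly_eval_def
  using assms by (intro sum_nonneg mult_nonneg_nonneg prod_nonneg zero_le_power)
    (auto simp: nonneg_coeffs_def mpoly_vars_def)

lemma mpoly_eval_mono:
  assumes "nonneg_coeffs f" "mpoly_vars f \<subseteq> A" "\<And>i. i \<in> A \<Longrightarrow> 0 \<le> x i \<and> x i \<le> y i"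
  shows "mpoly_eval f x \<le> mpoly_eval f y"
  unfolding mpoly_eval_def
proof (intro sum_mono mult_left_mono prod_mono conjI power_mono zero_le_power)
  fix m i assume "m \<in> Poly_Mapping.keys f" "i \<in> Poly_Mapping.keys m"
  then have "i \<in> A" using assms(2) by (auto simp: mpoly_vars_def)
  then show "0 \<le> x i" "0 \<le> x i" "x i \<le> y i" using assms(3) by auto
qed (use assms(1) in \<open>auto simp: nonneg_coeffs_def\<close>)

lemma mpoly_eval_measurable:
  assumes "\<And>i. i \<in> mpoly_vars f \<Longrightarrow> (\<lambda>w. g w i) \<in> borel_measurable M"
  shows "(\<lambda>w. mpoly_eval f (g w)) \<in> borel_measurable M"
  unfolding mpoly_eval_def
  by (intro borel_measurable_sum borel_measurable_times borel_measurable_prod borel_measurable_power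
      borel_measurable_const assms) (auto simp: mpoly_vars_def)

lemma mem_region_iff:
  assumes "r \<ge> 1"
  shows "u \<in> region r s F X \<longleftrightarrow>
    u \<in> {1..r} \<rightarrow>\<^sub>E {1..} \<and> (\<forall>i\<in>{1..r}. \<bar>u i\<bar> \<le> X) \<and> (\<forall>j\<in>{1..s}. \<bar>mpoly_eval (F j) u\<bar> \<le> X)"
proof -
  have "height (r + s) (graph_map r s F u) \<le> X \<longleftrightarrow> (\<forall>i\<in>{1..r + s}. \<bar>graph_map r s F u i\<bar> \<le> X)"
    using assms by (intro height_le_iff) simp
  also have "\<dots> \<longleftrightarrow> (\<forall>i\<in>{1..r}. \<bar>u i\<bar> \<le> X) \<and> (\<forall>j\<in>{1..s}. \<bar>mpoly_eval (F j) u\<bar> \<le> X)"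
  proof (intro iffI conjI ballI)
    fix j assume h: "\<forall>i\<in>{1..r + s}. \<bar>graph_map r s F u i\<bar> \<le> X" and "j \<in> {1..s}"
    then show "\<bar>mpoly_eval (F j) u\<bar> \<le> X"
      using bspec[OF h, of "j + r"] by (simp add: graph_map_def)
  next
    fix i assume h: "\<forall>i\<in>{1..r + s}. \<bar>graph_map r s F u i\<bar> \<le> X" and "i \<in> {1..r}"
    then show "\<bar>u i\<bar> \<le> X" using bspec[OF h, of i] by (simp add: graph_map_def)
  next
    fix i assume h: "(\<forall>i\<in>{1..r}. \<bar>u i\<bar> \<le> X) \<and> (\<forall>j\<in>{1..s}. \<bar>mpoly_eval (F j) u\<bar> \<le> X)"
      and i: "i \<in> {1..r + s}"
    have "i - r \<in> {1..s}" if "\<not> i \<le> r" using i that by auto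
    then show "\<bar>graph_map r s F u i\<bar> \<le> X" using h i by (simp add: graph_map_def)
  qed
  finally show ?thesis by (simp add: region_def)
qed

text \<open>The region is down-closed because the polynomials have nonnegative coefficients. Hence its
  projection to the coordinates in \<open>J\<close> is the section in which all other coordinates equal \<open>1\<close>;
  this makes the projections measurable.\<close>

lemma down_region_region:
  assumes r: "r \<ge> 1"
    and vars: "\<forall>j\<in>{1..s}. mpoly_vars (F j) \<subseteq> {1..r}"
    and nonneg: "\<forall>j\<in>{1..s}. nonneg_coeffs (F j)"
  shows "down_region {1..r} (region r s F X) X"
proof
  show "region r s F X \<subseteq> {1..r} \<rightarrow>\<^sub>E {1..X}"
  proof
    fix u assume "u \<in> region r s F X"
    then have u: "u \<in> {1..r} \<rightarrow>\<^sub>E {1..}" "\<forall>i\<in>{1..r}. \<bar>u i\<bar> \<le> X"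
      by (simp_all add: mem_region_iff[OF r])
    then have "u i \<in> {1..X}" if "i \<in> {1..r}" for i using that by (fastforce simp: PiE_iff)
    then show "u \<in> {1..r} \<rightarrow>\<^sub>E {1..X}" using u(1) by (simp add: PiE_iff)
  qed
  show down: "w \<in> region r s F X"
    if u: "u \<in> region r s F X" and w: "w \<in> {1..r} \<rightarrow>\<^sub>E {1..}" and le: "\<And>i. i \<in> {1..r} \<Longrightarrow> w i \<le> u i"
    for u w
  proof -
    have wu: "0 \<le> w i \<and> w i \<le> u i" if "i \<in> {1..r}" for i
    proof -
      have "1 \<le> w i" using w that by (auto simp: PiE_iff)
      then show ?thesis using le[OF that] by linarith
    qed
    have "\<bar>mpoly_eval (F j) w\<bar> \<le> X" if j: "j \<in> {1..s}" for j
    proof -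
      have "0 \<le> mpoly_eval (F j) w" "mpoly_eval (F j) w \<le> mpoly_eval (F j) u"
        using mpoly_eval_nonneg[of "F j" "{1..r}" w] mpoly_eval_mono[of "F j" "{1..r}" w u]
          wu vars nonneg j by blast+
      moreover have "\<bar>mpoly_eval (F j) u\<bar> \<le> X" using u j by (simp add: mem_region_iff[OF r])
      ultimately show ?thesis by linarith
    qed
    moreover have "\<bar>w i\<bar> \<le> X" if "i \<in> {1..r}" for i
    proof -
      have "\<bar>u i\<bar> \<le> X" using u that by (simp add: mem_region_iff[OF r])
      then show ?thesis using wu[OF that] by linarith
    qed
    ultimately show ?thesis using w by (simp add: mem_region_iff[OF r])
  qed
  show "(\<lambda>u. restrict u J) ` region r s F X \<in> sets (Pi\<^sub>M J (\<lambda>_. lborel))" if J: "J \<subseteq> {1..r}" for J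
  proof -
    let ?M = "Pi\<^sub>M J (\<lambda>_. lborel :: real measure)"
    define ext where "ext w = (\<lambda>i\<in>{1..r}. if i \<in> J then w i else 1)" for w :: "nat \<Rightarrow> real"
    have eq: "(\<lambda>u. restrict u J) ` region r s F X = {w \<in> space ?M. (\<forall>i\<in>J. 1 \<le> w i) \<and>
        (\<forall>i\<in>{1..r}. \<bar>ext w i\<bar> \<le> X) \<and> (\<forall>j\<in>{1..s}. \<bar>mpoly_eval (F j) (ext w)\<bar> \<le> X)}"
      (is "?L = ?R")
    proof (intro equalityI subsetI)
      fix w assume "w \<in> ?L"
      then obtain u where u: "u \<in> region r s F X" "w = restrict u J" by blast
      then have uI: "u \<in> {1..r} \<rightarrow>\<^sub>E {1..}" by (simp add: mem_region_iff[OF r])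
      have ge: "1 \<le> u i" if "i \<in> {1..r}" for i using uI that by (auto simp: PiE_iff)
      have "ext w \<in> region r s F X"
        by (rule down[OF u(1)]) (use ge J u(2) in \<open>auto simp: ext_def PiE_iff\<close>)
      moreover have "\<forall>i\<in>J. 1 \<le> w i" using ge J u(2) by auto
      moreover have "w \<in> space ?M" using u(2) by (simp add: space_PiM)
      ultimately show "w \<in> ?R" by (simp add: mem_region_iff[OF r])
    next
      fix w assume w: "w \<in> ?R"
      then have "ext w \<in> {1..r} \<rightarrow>\<^sub>E {1..}" by (auto simp: ext_def)
      then have "ext w \<in> region r s F X" using w by (simp add: mem_region_iff[OF r])
      moreover have "restrict (ext w) J i = w i" for i
        using w J by (cases "i \<in> J") (auto simp: ext_def space_PiM PiE_iff extensional_def)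
      then have "w = restrict (ext w) J" by (intro ext) simp
      ultimately show "w \<in> ?L" by blast
    qed
    have comp: "(\<lambda>w. w i) \<in> borel_measurable ?M" if "i \<in> J" for i
      using measurable_component_singleton[OF that, of "\<lambda>_. lborel :: real measure"] by simp
    have ext_meas: "(\<lambda>w. ext w i) \<in> borel_measurable ?M" for i
    proof -
      have "(\<lambda>w. ext w i) = (if i \<in> J then (\<lambda>w. w i) else (\<lambda>_. if i \<in> {1..r} then 1 else undefined))"
        using J by (auto simp: ext_def)
      then show ?thesis using comp[of i] by simp
    qed
    have poly: "(\<lambda>w. mpoly_eval (F j) (ext w)) \<in> borel_measurable ?M" for j
      by (rule mpoly_eval_measurable) (rule ext_meas)
    have finJ: "finite J" using J finite_subset by blast
    show ?thesis
      unfolding eq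
      by (intro sets.sets_Collect sets.sets_Collect_finite_All finJ finite_atLeastAtMost
          borel_measurable_le borel_measurable_const borel_measurable_abs comp ext_meas poly)
  qed
qed auto

section \<open>Counting branch points\<close>

lemma mem_branch_locus_iff:
  assumes "r \<ge> 1" "\<forall>j\<in>{1..s}. mpoly_vars (F j) \<subseteq> {1..r}"
  shows "P \<in> branch_locus (r + s) (radial_graph_family r s F) \<longleftrightarrow>
    (\<exists>x :: nat \<Rightarrow> int. (\<forall>i\<in>{1..r}. x i \<ge> 1) \<and> P = graph_map r s F (\<lambda>i. of_int (x i)))"
proof -
  have "branch_locus (r + s) (radial_graph_family r s F) =
      {graph_map r s F (\<lambda>i. of_int (x i)) |x :: nat \<Rightarrow> int. \<forall>i\<in>{1..r}. x i \<ge> 1}"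
    by (rule branch_locus_radial_graph_family[OF assms(1) bspec[OF assms(2)]])
  then show ?thesis by blast
qed

text \<open>The graph map is injective on integral base points because it contains them as its first
  coordinates, and the height condition is the one that defines the region.\<close>

lemma card_branch_points_eq_card_lattice_points:
  assumes r: "r \<ge> 1" and vars: "\<forall>j\<in>{1..s}. mpoly_vars (F j) \<subseteq> {1..r}"
  shows "card {P \<in> branch_points_upto (r + s) (radial_graph_family r s F) X. Q P}
       = card {x \<in> lattice_points {1..r} (region r s F X) 1. Q (graph_map r s F (\<lambda>i. of_int (x i)))}"
proof -
  let ?f = "\<lambda>x. graph_map r s F (\<lambda>i. real_of_int (x i))"
  let ?A = "{x \<in> lattice_points {1..r} (region r s F X) 1. Q (?f x)}"
  have height: "(\<lambda>i\<in>{1..r}. real 1 * of_int (x i)) \<in> region r s F X \<longleftrightarrow> height (r + s) (?f x) \<le> X"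
    if "\<forall>i\<in>{1..r}. x i \<ge> 1" for x
  proof -
    have "graph_map r s F (\<lambda>i\<in>{1..r}. real 1 * of_int (x i)) = ?f x"
      by (rule graph_map_cong[OF vars[rule_format]]) auto
    moreover have "(\<lambda>i\<in>{1..r}. real 1 * of_int (x i)) \<in> {1..r} \<rightarrow>\<^sub>E {1..}" using that by auto
    ultimately show ?thesis by (simp add: region_def)
  qed
  have inj: "inj_on ?f ?A"
  proof (rule inj_onI)
    fix x y assume xy: "x \<in> ?A" "y \<in> ?A" "?f x = ?f y"
    have "x i = y i" if "i \<in> {1..r}" for i
      using fun_cong[OF xy(3), of i] that by (simp add: graph_map_def)
    moreover have "x \<in> {1..r} \<rightarrow>\<^sub>E {1..}" "y \<in> {1..r} \<rightarrow>\<^sub>E {1..}"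
      using xy by (auto simp: lattice_points_def)
    ultimately show "x = y" by (meson PiE_ext)
  qed
  have image: "?f ` ?A = {P \<in> branch_points_upto (r + s) (radial_graph_family r s F) X. Q P}"
  proof (intro equalityI subsetI)
    fix P assume "P \<in> ?f ` ?A"
    then obtain x where x: "x \<in> ?A" "P = ?f x" by blast
    then have "\<forall>i\<in>{1..r}. x i \<ge> 1" by (auto simp: lattice_points_def PiE_iff)
    then show "P \<in> {P \<in> branch_points_upto (r + s) (radial_graph_family r s F) X. Q P}"
      using x height[of x] mem_branch_locus_iff[OF r vars, of P]
      by (auto simp: branch_points_upto_def lattice_points_def)
  next
    fix P assume P: "P \<in> {P \<in> branch_points_upto (r + s) (radial_graph_family r s F) X. Q P}"
    then obtain x where x: "\<forall>i\<in>{1..r}. x i \<ge> 1" "P = ?f x"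
      using mem_branch_locus_iff[OF r vars, of P] by (auto simp: branch_points_upto_def)
    define y where "y = restrict x {1..r}"
    have y: "\<forall>i\<in>{1..r}. y i \<ge> 1" "y \<in> {1..r} \<rightarrow>\<^sub>E {1..}" using x(1) by (auto simp: y_def)
    have "?f x = ?f y"
      by (rule graph_map_cong[OF vars[rule_format]]) (simp_all add: y_def)
    then have "P = ?f y" using x(2) by simp
    moreover have "height (r + s) P \<le> X" using P by (simp add: branch_points_upto_def)
    ultimately have "y \<in> ?A" using P y height[OF y(1)] by (simp add: lattice_points_def)
    then show "P \<in> ?f ` ?A" using \<open>P = ?f y\<close> by blast
  qed
  show ?thesis using card_image[OF inj] unfolding image by simp
qed

lemma smallo_of_ratio_tendsto:
  fixes f V :: "real \<Rightarrow> real"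
  assumes "((\<lambda>X. f X / V X) \<longlongrightarrow> c) at_top" "eventually (\<lambda>X. V X > 0) at_top"
  shows "(\<lambda>X. f X - V X * c) \<in> o[at_top](V)"
proof (rule smalloI_tendsto)
  have "((\<lambda>X. f X / V X - c) \<longlongrightarrow> 0) at_top"
    using tendsto_diff[OF assms(1) tendsto_const[of c]] by simp
  then show "((\<lambda>X. (f X - V X * c) / V X) \<longlongrightarrow> 0) at_top"
    by (rule Lim_transform_eventually)
       (use assms(2) in \<open>eventually_elim, simp add: diff_divide_distrib\<close>)
  show "eventually (\<lambda>X. V X \<noteq> 0) at_top" using assms(2) by eventually_elim simp
qed

theorem theorem4p3:
  fixes r s :: nat
    and F :: "nat \<Rightarrow> int_mpoly"
    and \<delta> :: "nat \<Rightarrow> nat"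
  defines "\<Psi> \<equiv> graph_map r s F"
    and "Y \<equiv> radial_graph_family r s F"
    and "V \<equiv> region_volume r s F"
    and "V\<^sub>j \<equiv> projection_volume r s F"
    and "D \<equiv> region_depth r s F"
  assumes "r \<ge> 2" and "s \<ge> 1"
    and "\<And>j. j \<in> {1..s} \<Longrightarrow> mpoly_vars (F j) \<subseteq> {1..r}"
    and "\<And>j. j \<in> {1..s} \<Longrightarrow> F j \<noteq> 0"
    and "\<And>j. j \<in> {1..s} \<Longrightarrow> \<delta> j \<ge> 1"
    and "\<And>j. j \<in> {1..s} \<Longrightarrow> homogeneous (\<delta> j) (F j)"
    and "\<And>j. j \<in> {1..s} \<Longrightarrow> nonneg_coeffs (F j)"
    and "filterlim V at_top at_top"
    and "filterlim D at_top at_top"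
    and "(\<lambda>X. D X + V\<^sub>j 1 X * ln (2 * D X) + (\<Sum>j = 2..r - 1. V\<^sub>j j X)) \<in> o[at_top](V)"
  shows
    "(\<forall>x :: nat \<Rightarrow> int. (\<forall>i\<in>{1..r}. x i \<ge> 1) \<longrightarrow>
        (globally_visible (r + s) Y (\<Psi> (\<lambda>i. of_int (x i))) \<longleftrightarrow> Gcd (x ` {1..r}) = 1)) \<and>
     (\<forall>p :: nat. prime p \<longrightarrow> (\<forall>x :: nat \<Rightarrow> int. (\<forall>i\<in>{1..r}. x i \<ge> 1) \<longrightarrow>
        (padically_visible (r + s) Y p (\<Psi> (\<lambda>i. of_int (x i))) \<longleftrightarrow>
           \<not> (\<forall>i\<in>{1..r}. int p dvd x i)))) \<and>
     (\<forall>P\<in>branch_locus (r + s) Y.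
        globally_visible (r + s) Y P \<longleftrightarrow>
          (\<forall>p :: nat. prime p \<longrightarrow> padically_visible (r + s) Y p P)) \<and>
     (\<lambda>X. real (card (branch_points_upto (r + s) Y X)) - V X) \<in> o[at_top](V) \<and>
     (\<lambda>X. real (card (visible_points_upto (r + s) Y X)) - V X / real_zeta (real r)) \<in> o[at_top](V) \<and>
     (\<forall>p :: nat. prime p \<longrightarrow>
        (padic_visible_proportion (r + s) Y p \<longlongrightarrow> padic_visible_density (r + s) Y p) at_top \<and>
        padic_visible_density (r + s) Y p = 1 - 1 / real p ^ r) \<and>
     (visible_proportion (r + s) Y \<longlongrightarrow> visible_density (r + s) Y) at_top \<and>
     visible_density (r + s) Y = 1 / real_zeta (real r) \<and>
     (\<lambda>p :: nat. if prime p then padic_visible_density (r + s) Y p else 1)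
       has_prod visible_density (r + s) Y"
proof -
  have r1: "r \<ge> 1" and ne: "{1..r} \<noteq> {}" using assms(6) by auto
  have vars: "\<forall>j\<in>{1..s}. mpoly_vars (F j) \<subseteq> {1..r}"
    and deg: "\<forall>j\<in>{1..s}. \<delta> j \<ge> 1"
    and hom: "\<forall>j\<in>{1..s}. homogeneous (\<delta> j) (F j)"
    and nonneg: "\<forall>j\<in>{1..s}. nonneg_coeffs (F j)"
    using assms by blast+
  have global: "globally_visible (r + s) Y (\<Psi> (\<lambda>i. of_int (x i))) \<longleftrightarrow> Gcd (x ` {1..r}) = 1"
    if "\<forall>i\<in>{1..r}. x i \<ge> 1" for x
    unfolding \<Psi>_def Y_def by (rule globally_visible_iff_Gcd[OF that r1 vars])
  have padic: "padically_visible (r + s) Y p (\<Psi> (\<lambda>i. of_int (x i))) \<longleftrightarrow> \<not> (\<forall>i\<in>{1..r}. int p dvd x i)"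
    if "prime p" "\<forall>i\<in>{1..r}. x i \<ge> 1" for p x
    unfolding \<Psi>_def Y_def by (rule padically_visible_iff_not_dvd[OF that r1 vars deg hom])
  have local_iff: "globally_visible (r + s) Y P \<longleftrightarrow> (\<forall>p::nat. prime p \<longrightarrow> padically_visible (r + s) Y p P)"
    if P: "P \<in> branch_locus (r + s) Y" for P
  proof -
    obtain x :: "nat \<Rightarrow> int" where x: "\<forall>i\<in>{1..r}. x i \<ge> 1" and eq: "P = \<Psi> (\<lambda>i. of_int (x i))"
      using P mem_branch_locus_iff[OF r1 vars] unfolding \<Psi>_def Y_def by blast
    show ?thesis
      unfolding eq global[OF x] Gcd_eq_1_iff_no_prime_dvd[OF x ne] using padic[OF _ x] by blast
  qed

  let ?R = "region r s F" and ?I = "{1..r}"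
  have reg: "down_region ?I (?R X) X" for X
    by (rule down_region_region[OF r1 vars nonneg])
  have V: "V X = shadow_volume (?R X) ?I" for X
    unfolding V_def region_volume_def shadow_volume_def down_region.restrict_I[OF reg] ..
  have W: "V\<^sub>j j X = shadow_sum ?I (?R X) j" for j X
    unfolding V\<^sub>j_def projection_volume_def shadow_sum_def shadow_volume_def ..
  have D: "D X = depth ?I (?R X)" for X
    unfolding D_def region_depth_def depth_def ..
  interpret fam: sparse_family ?I ?R "\<lambda>X. X"
  proof (rule sparse_family.intro)
    show "down_region ?I (?R X) X" for X by (rule reg)
    show "2 \<le> card ?I" using assms(6) by simp
    show "filterlim (\<lambda>X. shadow_volume (?R X) ?I) at_top at_top"
      using assms(13) by (simp only: V[symmetric])
    show "filterlim (\<lambda>X. depth ?I (?R X)) at_top at_top"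
      using assms(14) by (simp only: D[symmetric])
    show "(\<lambda>X. boundary_error ?I (?R X)) \<in> o[at_top](\<lambda>X. shadow_volume (?R X) ?I)"
    proof -
      have "boundary_error ?I (?R X) = D X + V\<^sub>j 1 X * ln (2 * D X) + (\<Sum>j = 2..r - 1. V\<^sub>j j X)" for X
        unfolding boundary_error_def V W D by simp
      then show ?thesis using assms(15) by (simp only: V[symmetric])
    qed
  qed
  have Vpos: "eventually (\<lambda>X. V X > 0) at_top"
    using fam.eventually_large by eventually_elim (simp add: V)
  have count: "card {P \<in> branch_points_upto (r + s) Y X. Q P}
      = card {x \<in> lattice_points ?I (?R X) 1. Q (\<Psi> (\<lambda>i. of_int (x i)))}" for Q X
    unfolding Y_def \<Psi>_def by (rule card_branch_points_eq_card_lattice_points[OF r1 vars])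
  have ge1: "\<forall>i\<in>?I. x i \<ge> 1" if "x \<in> lattice_points ?I (?R X) 1" for x X
    using that by (auto simp: lattice_points_def PiE_iff)
  have all: "card (branch_points_upto (r + s) Y X) = card (sieved_points ?I (?R X) {} 1)" for X
    using count[of X "\<lambda>_. True"] by (simp add: sieved_points_def)
  have vis: "card (visible_points_upto (r + s) Y X) = card (sieved_points ?I (?R X) {p. prime p} 1)" for X
  proof -
    have "x \<in> lattice_points ?I (?R X) 1 \<and> globally_visible (r + s) Y (\<Psi> (\<lambda>i. of_int (x i)))
        \<longleftrightarrow> x \<in> sieved_points ?I (?R X) {p. prime p} 1" for x
      using global[OF ge1[of x X]] Gcd_eq_1_iff_no_prime_dvd[OF ge1[of x X] ne]
      unfolding sieved_points_def by blast
    then show ?thesis unfolding visible_points_upto_def count by simp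
  qed
  have pvis: "card (padically_visible_points_upto (r + s) Y p X) = card (sieved_points ?I (?R X) {p} 1)"
    if "prime p" for p X
  proof -
    have "x \<in> lattice_points ?I (?R X) 1 \<and> padically_visible (r + s) Y p (\<Psi> (\<lambda>i. of_int (x i)))
        \<longleftrightarrow> x \<in> sieved_points ?I (?R X) {p} 1" for x
      using padic[OF that ge1[of x X]] unfolding sieved_points_def by blast
    then show ?thesis unfolding padically_visible_points_upto_def count by simp
  qed

  have lim_all: "((\<lambda>X. real (card (branch_points_upto (r + s) Y X)) / V X) \<longlongrightarrow> 1) at_top"
    using fam.sieved_points_tendsto[of "{}" 1] by (simp add: all V)
  have lim_vis: "((\<lambda>X. real (card (visible_points_upto (r + s) Y X)) / V X)
      \<longlongrightarrow> 1 / real_zeta (real r)) at_top"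
    using fam.primitive_points_tendsto by (simp add: vis V)
  have lim_pvis: "((\<lambda>X. real (card (padically_visible_points_upto (r + s) Y p X)) / V X)
      \<longlongrightarrow> 1 - 1 / real p ^ r) at_top" if "prime p" for p
    using fam.sieved_points_tendsto[of "{p}" 1] that by (simp add: pvis[OF that] V)
  \<comment> \<open>The number of branch points is asymptotic to the volume, so it may replace the volume in the
    denominators.\<close>
  have ratio: "((\<lambda>X. f X / real (card (branch_points_upto (r + s) Y X))) \<longlongrightarrow> c) at_top"
    if "((\<lambda>X. f X / V X) \<longlongrightarrow> c) at_top" for f c
  proof -
    have "((\<lambda>X. (f X / V X) / (real (card (branch_points_upto (r + s) Y X)) / V X)) \<longlongrightarrow> c / 1) at_top"
      by (intro tendsto_divide that lim_all) simp
    then have "((\<lambda>X. (f X / V X) / (real (card (branch_points_upto (r + s) Y X)) / V X)) \<longlongrightarrow> c) at_top"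
      by simp
    then show ?thesis
      by (rule Lim_transform_eventually) (use Vpos in \<open>eventually_elim, simp\<close>)
  qed
  have proportion: "(visible_proportion (r + s) Y \<longlongrightarrow> 1 / real_zeta (real r)) at_top"
    using ratio[OF lim_vis] unfolding visible_proportion_def[abs_def] .
  have pprop: "(padic_visible_proportion (r + s) Y p \<longlongrightarrow> 1 - 1 / real p ^ r) at_top" if "prime p" for p
    using ratio[OF lim_pvis[OF that]] unfolding padic_visible_proportion_def[abs_def] .
  have dens: "visible_density (r + s) Y = 1 / real_zeta (real r)"
    unfolding visible_density_def by (rule tendsto_Lim[OF _ proportion]) simp
  have pdens: "padic_visible_density (r + s) Y p = 1 - 1 / real p ^ r" if "prime p" for p
    unfolding padic_visible_density_def by (rule tendsto_Lim[OF _ pprop[OF that]]) simp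
  have "(\<lambda>p. if prime p then padic_visible_density (r + s) Y p else 1)
      = (\<lambda>p. if prime p then 1 - 1 / real p ^ r else 1)"
    using pdens by auto
  then have euler: "(\<lambda>p. if prime p then padic_visible_density (r + s) Y p else 1)
      has_prod visible_density (r + s) Y"
    using euler_product_has_prod[OF assms(6)] by (simp only: dens)
  have "(\<lambda>X. real (card (branch_points_upto (r + s) Y X)) - V X) \<in> o[at_top](V)"
    using smallo_of_ratio_tendsto[OF lim_all Vpos] by simp
  moreover have "(\<lambda>X. real (card (visible_points_upto (r + s) Y X)) - V X / real_zeta (real r)) \<in> o[at_top](V)"
    using smallo_of_ratio_tendsto[OF lim_vis Vpos] by simp
  moreover have "(padic_visible_proportion (r + s) Y p \<longlongrightarrow> padic_visible_density (r + s) Y p) at_top"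
    if "prime p" for p
    using pprop[OF that] pdens[OF that] by simp
  moreover have "(visible_proportion (r + s) Y \<longlongrightarrow> visible_density (r + s) Y) at_top"
    using proportion dens by simp
  ultimately show ?thesis
    by (intro conjI allI impI global padic ballI[OF local_iff] dens pdens euler)
qed

end
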